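(* Let $TA$ be a timelock-free, non-Zeno timed automaton over $\Sigma$ and $\mathcal{A}$. Then for every TCTL formula $\phi$, $[\![\phi]\!]_{TA}=[\![\mathrm{emb}_{tn}(\phi)]\!]_{TA}$.
   Context: Timed automata. Fix countably infinite disjoint sets $\mathbb{C}_A$ (automaton clocks) and $\mathbb{C}_F$ (freeze clocks), $\mathbb{C}=\mathbb{C}_A\cup\mathbb{C}_F$. Clock constraints: $g::=x\bowtie c\mid x-x'\bowtie c\mid g\wedge g$ with $c\in\mathbb{N}$, $\bowtie\in\{<,\le,>,\ge\}$; atomic ones (first two forms) form $\Phi_a(\mathbb{C})$. Valuations $v:\mathbb{C}\to\mathbb{R}_{\ge0}$ with $v+\delta$, $v[R:=0]$, $v[z:=\delta]$, $v\models g$ as usual. $\Sigma$ is a nonempty set of actions disjoint from $\mathbb{R}_{\ge0}$, $\mathcal{A}$ a set of atomic propositions disjoint from clock constraints. A timed automaton $TA=(L,L_0,CX,I,E,\mathcal{L})$: finite nonempty $L$, $\emptyset\ne L_0\subseteq L$, finite nonempty $CX\subseteq\mathbb{C}_A$, invariants $I(l)$ over $CX$, edges $E\subseteq L\times\Sigma\times\{\text{constraints over }CX\}\times2^{CX}\times L$, $\mathcal{L}:L\to2^{\mathcal{A}}$. Semantics: states $Q_{TA}=\{(l,v):v\models I(l)\}$; $(l,v)\xrightarrow{\delta}(l,v+\delta)$ ($\delta\in\mathbb{R}_{\ge0}$) iff $v+\delta'\models I(l)$ for $0\le\delta'\le\delta$; $(l,v)\xrightarrow{a}(l',v[R:=0])$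 iff some $(l,a,g,R,l')\in E$ has $v\models g$ and $v[R:=0]\models I(l')$; labelling $\mathcal{L}_{TA}(l,v)=\mathcal{L}(l)\cup\{g\in\Phi_a(\mathbb{C}):v\models g\}$. $\delta(q)$ is the unique $q'$ with $q\xrightarrow{\delta}q'$ if it exists; $q[z:=0]$ resets $z$; $q\xrightarrow{K}q'$ means $q\xrightarrow{a}q'$ for some $a\in K$. Executions/runs: an execution from $q$ is a finite or infinite sequence of consecutive transitions starting at $q$; its duration is the sum of its delays; a run is an execution of infinite duration. $TA$ is timelock-free if every state in $Q_{TA}$ has at least one run, and non-Zeno if no state has an execution with infinitely many action transitions and finite duration. Positions of an execution: initial state, target of each transition, and for each delay transition $q_1\xrightarrow{\delta}q_2$ with $\delta>0$ the states $\delta'(q_1)$, $0<\delta'<\delta$, ordered by occurrence. An until path from $Q_1$ to $Q_2$: some position's state is in $Q_2$ and all strictly earlier positions' states are in $Q_1$. TCTL: $\phi::=A\mid\neg\phi\mid\phi\vee\phi\mid\mathsf{A}(\phi\mathsf{U}\phi)\mid\mathsf{E}(\phi\mathsf{U}\phi)\mid z.\phi$, $A\in\mathcal{A}\cup\Phi_a(\mathbb{C})$, $z\in\mathbb{C}_F$; $[\![A]\!]_{TA}=\{q:A\in\mathcal{L}_{TA}(q)\}$, complement, union, $[\![\mathsf{E}(\phi_1\mathsf{U}\phi_2)]\!]_{TA}$ = states having some run that is an until path from $[\![\phi_1\vee\phi_2]\!]_{TA}$ to $[\![\phi_2]\!]_{TA}$, $\mathsf{A}$ likewise with every run, $[\![z.\phi]\!]_{TA}=\{q:q[z:=0]\in[\![\phi]\!]_{TA}\}$.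 $L^{rel}_{\mu,\nu}$: $\phi::=A\mid Y\mid\neg\phi\mid\phi\vee\phi\mid\langle K\rangle\phi\mid\exists_\phi\phi\mid z.\phi\mid\mu Y.\phi$ ($Y$ a propositional variable, $K\subseteq\Sigma$, $z\in\mathbb{C}_F$, free occurrences of $Y$ in $\mu Y.\phi$ under an even number of negations). For environment $\theta$: atoms via $\mathcal{L}_{TA}$, $[\![Y]\!]=\theta(Y)$, complement, union, $[\![\langle K\rangle\phi]\!]=\{q:\exists q'.\,q\xrightarrow{K}q'\in[\![\phi]\!]\}$, $[\![\exists_{\phi_1}\phi_2]\!]=\{q:\exists\delta.\ \delta(q)\in[\![\phi_2]\!]\wedge\forall\delta'<\delta.\ \delta'(q)\in[\![\phi_1\vee\phi_2]\!]\}$, $[\![z.\phi]\!]=\{q:q[z:=0]\in[\![\phi]\!]\}$, $[\![\mu Y.\phi]\!]_\theta=\bigcap\{S:[\![\phi]\!]_{\theta[Y:=S]}\subseteq S\}$. For closed formulas the semantics is independent of $\theta$ and written $[\![\phi]\!]_{TA}$. Abbreviations: $\wedge$, $\Rightarrow$; $[K]\phi=\neg\langle K\rangle\neg\phi$; $\mathsf{tt}=(x\ge0)$, $\mathsf{ff}=(x<0)$; $\forall_{\phi_1}\phi_2=\neg\exists_{\neg\phi_1}\neg\phi_2$; $\exists\gamma=\exists_{\mathsf{tt}}\gamma$; $\forall\gamma=\forall_{\mathsf{ff}}\gamma$; for a fixed $z\in\mathbb{C}_F$, $\mathsf{TS}=z.(\forall\,z<1)$ and $\mathrm{au}(\gamma_1,\gamma_2)=\exists_{\gamma_1}(\gamma_2\vee(\mathsf{TS}\wedge\forall\gamma_1))$.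 Translation $\mathrm{emb}_{tn}$: $\mathrm{emb}_{tn}(A)=A$; $\mathrm{emb}_{tn}(\neg\phi)=\neg\mathrm{emb}_{tn}(\phi)$; $\mathrm{emb}_{tn}(\phi_1\vee\phi_2)=\mathrm{emb}_{tn}(\phi_1)\vee\mathrm{emb}_{tn}(\phi_2)$; $\mathrm{emb}_{tn}(\mathsf{E}(\phi_1\mathsf{U}\phi_2))=\mu X.\exists_{\mathrm{emb}_{tn}(\phi_1)}(\mathrm{emb}_{tn}(\phi_2)\vee(\mathrm{emb}_{tn}(\phi_1)\wedge\langle\Sigma\rangle X))$; $\mathrm{emb}_{tn}(\mathsf{A}(\phi_1\mathsf{U}\phi_2))=\mu X.\mathrm{au}(\mathrm{emb}_{tn}(\phi_1)\wedge[\Sigma]X,\ \mathrm{emb}_{tn}(\phi_2))$; $\mathrm{emb}_{tn}(z.\phi)=z.\mathrm{emb}_{tn}(\phi)$. These formulas are closed. *)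

theory Defs
  imports Complex_Main "HOL-Library.Extended_Nat" "HOL-Library.Extended_Nonnegative_Real"
begin

datatype clock = AutClock nat | FreezeClock nat

datatype cmp = Lt | Le | Gt | Ge

datatype atomic_constraint =
    Single clock cmp nat
  | Diff clock clock cmp nat

datatype constraint =
    AtomC atomic_constraint
  | AndC constraint constraint

text \<open>Only functions with nonnegative values count as valuations; this is imposed in
  the state space of a timed automaton.\<close>

type_synonym valuation = "clock \<Rightarrow> real"

fun cmp_holds :: "cmp \<Rightarrow> real \<Rightarrow> real \<Rightarrow> bool" where
  "cmp_holds Lt a b \<longleftrightarrow> a < b"
| "cmp_holds Le a b \<longleftrightarrow> a \<le> b"
| "cmp_holds Gt a b \<longleftrightarrow> a > b"
| "cmp_holds Ge a b \<longleftrightarrow> a \<ge> b"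

fun sat_atomic :: "valuation \<Rightarrow> atomic_constraint \<Rightarrow> bool" where
  "sat_atomic v (Single x r c) \<longleftrightarrow> cmp_holds r (v x) (real c)"
| "sat_atomic v (Diff x y r c) \<longleftrightarrow> cmp_holds r (v x - v y) (real c)"

fun sat_constraint :: "valuation \<Rightarrow> constraint \<Rightarrow> bool" where
  "sat_constraint v (AtomC g) \<longleftrightarrow> sat_atomic v g"
| "sat_constraint v (AndC g h) \<longleftrightarrow> sat_constraint v g \<and> sat_constraint v h"

fun constraint_over :: "clock set \<Rightarrow> constraint \<Rightarrow> bool" where
  "constraint_over C (AtomC (Single x r c)) \<longleftrightarrow> x \<in> C"
| "constraint_over C (AtomC (Diff x y r c)) \<longleftrightarrow> x \<in> C \<and> y \<in> C"
| "constraint_over C (AndC g h) \<longleftrightarrow> constraint_over C g \<and> constraint_over C h"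

definition shift_val :: "valuation \<Rightarrow> real \<Rightarrow> valuation" where
  "shift_val v d = (\<lambda>x. v x + d)"

definition reset_val :: "valuation \<Rightarrow> clock set \<Rightarrow> valuation" where
  "reset_val v R = (\<lambda>x. if x \<in> R then 0 else v x)"

text \<open>The action alphabet \<open>\<Sigma>\<close> is the type \<open>'a\<close>, the set of atomic
  propositions is the type \<open>'p\<close>. The edge set is not required to be finite.\<close>

record ('l, 'a, 'p) ta =
  ta_locs :: "'l set"
  ta_init :: "'l set"
  ta_clks :: "clock set"
  ta_inv :: "'l \<Rightarrow> constraint"
  ta_edges :: "('l \<times> 'a \<times> constraint \<times> clock set \<times> 'l) set"
  ta_props :: "'l \<Rightarrow> 'p set"

definition timed_automaton :: "('l, 'a, 'p) ta \<Rightarrow> bool" where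
  "timed_automaton TA \<longleftrightarrow>
     finite (ta_locs TA) \<and> ta_locs TA \<noteq> {} \<and>
     ta_init TA \<noteq> {} \<and> ta_init TA \<subseteq> ta_locs TA \<and>
     finite (ta_clks TA) \<and> ta_clks TA \<noteq> {} \<and> ta_clks TA \<subseteq> range AutClock \<and>
     (\<forall>l \<in> ta_locs TA. constraint_over (ta_clks TA) (ta_inv TA l)) \<and>
     (\<forall>(l, a, g, R, l') \<in> ta_edges TA.
        l \<in> ta_locs TA \<and> constraint_over (ta_clks TA) g \<and> R \<subseteq> ta_clks TA \<and> l' \<in> ta_locs TA)"

type_synonym 'l state = "'l \<times> valuation"

definition ta_states :: "('l, 'a, 'p) ta \<Rightarrow> 'l state set" where
  "ta_states TA =
     {(l, v). l \<in> ta_locs TA \<and> (\<forall>x. 0 \<le> v x) \<and> sat_constraint v (ta_inv TA l)}"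

datatype 'a label = Delay real | Act 'a

inductive ta_step :: "('l, 'a, 'p) ta \<Rightarrow> 'l state \<Rightarrow> 'a label \<Rightarrow> 'l state \<Rightarrow> bool"
  for TA :: "('l, 'a, 'p) ta" where
  delay: "(l, v) \<in> ta_states TA \<Longrightarrow> 0 \<le> d \<Longrightarrow>
     \<forall>d'. 0 \<le> d' \<and> d' \<le> d \<longrightarrow> sat_constraint (shift_val v d') (ta_inv TA l) \<Longrightarrow>
     ta_step TA (l, v) (Delay d) (l, shift_val v d)"
| action: "(l, v) \<in> ta_states TA \<Longrightarrow> (l, a, g, R, l') \<in> ta_edges TA \<Longrightarrow>
     sat_constraint v g \<Longrightarrow> sat_constraint (reset_val v R) (ta_inv TA l') \<Longrightarrow>
     ta_step TA (l, v) (Act a) (l', reset_val v R)"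

datatype 'p atom = Prop 'p | Clk atomic_constraint

fun ta_label :: "('l, 'a, 'p) ta \<Rightarrow> 'l state \<Rightarrow> 'p atom set" where
  "ta_label TA (l, v) = Prop ` ta_props TA l \<union> Clk ` {g. sat_atomic v g}"

definition freeze_state :: "nat \<Rightarrow> 'l state \<Rightarrow> 'l state" where
  "freeze_state z q = (fst q, reset_val (snd q) {FreezeClock z})"

text \<open>An execution consists of the transitions
  \<open>(ex_state i, ex_label i, ex_state (i + 1))\<close> with \<open>i < ex_len\<close>; it is infinite iff
  \<open>ex_len = \<infinity>\<close>. Entries beyond the length are irrelevant.\<close>

record ('l, 'a) execution =
  ex_len :: enat
  ex_state :: "nat \<Rightarrow> 'l state"
  ex_label :: "nat \<Rightarrow> 'a label"

definition execution_from ::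
  "('l, 'a, 'p) ta \<Rightarrow> 'l state \<Rightarrow> ('l, 'a) execution \<Rightarrow> bool" where
  "execution_from TA q \<rho> \<longleftrightarrow> q \<in> ta_states TA \<and> ex_state \<rho> 0 = q \<and>
     (\<forall>i. enat i < ex_len \<rho> \<longrightarrow>
        ta_step TA (ex_state \<rho> i) (ex_label \<rho> i) (ex_state \<rho> (Suc i)))"

fun label_delay :: "'a label \<Rightarrow> real" where
  "label_delay (Delay d) = d"
| "label_delay (Act a) = 0"

definition duration :: "('l, 'a) execution \<Rightarrow> ennreal" where
  "duration \<rho> = (\<Sum>i. if enat i < ex_len \<rho> then ennreal (label_delay (ex_label \<rho> i)) else 0)"

definition run_from :: "('l, 'a, 'p) ta \<Rightarrow> 'l state \<Rightarrow> ('l, 'a) execution \<Rightarrow> bool" where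
  "run_from TA q \<rho> \<longleftrightarrow> execution_from TA q \<rho> \<and> duration \<rho> = \<infinity>"

definition timelock_free :: "('l, 'a, 'p) ta \<Rightarrow> bool" where
  "timelock_free TA \<longleftrightarrow> (\<forall>q \<in> ta_states TA. \<exists>\<rho>. run_from TA q \<rho>)"

definition non_zeno :: "('l, 'a, 'p) ta \<Rightarrow> bool" where
  "non_zeno TA \<longleftrightarrow> \<not> (\<exists>q \<in> ta_states TA. \<exists>\<rho>. execution_from TA q \<rho> \<and>
     infinite {i. enat i < ex_len \<rho> \<and> (\<exists>a. ex_label \<rho> i = Act a)} \<and> duration \<rho> < \<infinity>)"

text \<open>Position \<open>(i, 0)\<close> is the initial state (\<open>i = 0\<close>) or the target of the \<open>i\<close>-th
  transition (\<open>i > 0\<close>); position \<open>(i, d)\<close> with \<open>d > 0\<close> is a state strictly inside the delay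
  transition that starts in \<open>ex_state i\<close>. Occurrence order is lexicographic.\<close>

definition positions :: "('l, 'a) execution \<Rightarrow> (nat \<times> real) set" where
  "positions \<rho> = {(i, 0) | i. enat i \<le> ex_len \<rho>} \<union>
     {(i, d) | i d. enat i < ex_len \<rho> \<and> (\<exists>d1. ex_label \<rho> i = Delay d1 \<and> 0 < d \<and> d < d1)}"

fun position_state :: "('l, 'a) execution \<Rightarrow> nat \<times> real \<Rightarrow> 'l state" where
  "position_state \<rho> (i, d) = (fst (ex_state \<rho> i), shift_val (snd (ex_state \<rho> i)) d)"

fun position_less :: "nat \<times> real \<Rightarrow> nat \<times> real \<Rightarrow> bool" where
  "position_less (i, d) (j, e) \<longleftrightarrow> i < j \<or> (i = j \<and> d < e)"

definition until_path ::
  "('l, 'a) execution \<Rightarrow> 'l state set \<Rightarrow> 'l state set \<Rightarrow> bool" where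
  "until_path \<rho> Q1 Q2 \<longleftrightarrow> (\<exists>p \<in> positions \<rho>. position_state \<rho> p \<in> Q2 \<and>
     (\<forall>p' \<in> positions \<rho>. position_less p' p \<longrightarrow> position_state \<rho> p' \<in> Q1))"

datatype 'p tctl =
    TAtom "'p atom"
  | TNot "'p tctl"
  | TOr "'p tctl" "'p tctl"
  | TAU "'p tctl" "'p tctl"
  | TEU "'p tctl" "'p tctl"
  | TFreeze nat "'p tctl"

fun tctl_sem :: "('l, 'a, 'p) ta \<Rightarrow> 'p tctl \<Rightarrow> 'l state set" where
  "tctl_sem TA (TAtom A) = {q \<in> ta_states TA. A \<in> ta_label TA q}"
| "tctl_sem TA (TNot \<phi>) = ta_states TA - tctl_sem TA \<phi>"
| "tctl_sem TA (TOr \<phi>1 \<phi>2) = tctl_sem TA \<phi>1 \<union> tctl_sem TA \<phi>2"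
| "tctl_sem TA (TAU \<phi>1 \<phi>2) = {q \<in> ta_states TA. \<forall>\<rho>. run_from TA q \<rho> \<longrightarrow>
     until_path \<rho> (tctl_sem TA \<phi>1 \<union> tctl_sem TA \<phi>2) (tctl_sem TA \<phi>2)}"
| "tctl_sem TA (TEU \<phi>1 \<phi>2) = {q \<in> ta_states TA. \<exists>\<rho>. run_from TA q \<rho> \<and>
     until_path \<rho> (tctl_sem TA \<phi>1 \<union> tctl_sem TA \<phi>2) (tctl_sem TA \<phi>2)}"
| "tctl_sem TA (TFreeze z \<phi>) = {q \<in> ta_states TA. freeze_state z q \<in> tctl_sem TA \<phi>}"

text \<open>\<open>LEx \<phi>1 \<phi>2\<close> is the relativized delay modality \<open>\<exists>\<^bsub>\<phi>1\<^esub> \<phi>2\<close>. Propositional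
  variables are natural numbers. The datatype contains the raw syntax; \<open>lrel_wf\<close> singles
  out the formulas in which every fixpoint variable occurs positively.\<close>

datatype ('a, 'p) lrel =
    LAtom "'p atom"
  | LVar nat
  | LNot "('a, 'p) lrel"
  | LOr "('a, 'p) lrel" "('a, 'p) lrel"
  | LDia "'a set" "('a, 'p) lrel"
  | LEx "('a, 'p) lrel" "('a, 'p) lrel"
  | LFreeze nat "('a, 'p) lrel"
  | LMu nat "('a, 'p) lrel"

text \<open>\<open>lrel_parity b Y \<phi>\<close>: every free occurrence of \<open>Y\<close> in \<open>\<phi>\<close> is under an even
  (\<open>b = True\<close>) respectively odd (\<open>b = False\<close>) number of negations.\<close>

fun lrel_parity :: "bool \<Rightarrow> nat \<Rightarrow> ('a, 'p) lrel \<Rightarrow> bool" where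
  "lrel_parity b Y (LAtom A) \<longleftrightarrow> True"
| "lrel_parity b Y (LVar Z) \<longleftrightarrow> (Z = Y \<longrightarrow> b)"
| "lrel_parity b Y (LNot \<phi>) \<longleftrightarrow> lrel_parity (\<not> b) Y \<phi>"
| "lrel_parity b Y (LOr \<phi>1 \<phi>2) \<longleftrightarrow> lrel_parity b Y \<phi>1 \<and> lrel_parity b Y \<phi>2"
| "lrel_parity b Y (LDia K \<phi>) \<longleftrightarrow> lrel_parity b Y \<phi>"
| "lrel_parity b Y (LEx \<phi>1 \<phi>2) \<longleftrightarrow> lrel_parity b Y \<phi>1 \<and> lrel_parity b Y \<phi>2"
| "lrel_parity b Y (LFreeze z \<phi>) \<longleftrightarrow> lrel_parity b Y \<phi>"
| "lrel_parity b Y (LMu Z \<phi>) \<longleftrightarrow> Z = Y \<or> lrel_parity b Y \<phi>"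

fun lrel_wf :: "('a, 'p) lrel \<Rightarrow> bool" where
  "lrel_wf (LAtom A) \<longleftrightarrow> True"
| "lrel_wf (LVar Z) \<longleftrightarrow> True"
| "lrel_wf (LNot \<phi>) \<longleftrightarrow> lrel_wf \<phi>"
| "lrel_wf (LOr \<phi>1 \<phi>2) \<longleftrightarrow> lrel_wf \<phi>1 \<and> lrel_wf \<phi>2"
| "lrel_wf (LDia K \<phi>) \<longleftrightarrow> lrel_wf \<phi>"
| "lrel_wf (LEx \<phi>1 \<phi>2) \<longleftrightarrow> lrel_wf \<phi>1 \<and> lrel_wf \<phi>2"
| "lrel_wf (LFreeze z \<phi>) \<longleftrightarrow> lrel_wf \<phi>"
| "lrel_wf (LMu Y \<phi>) \<longleftrightarrow> lrel_parity True Y \<phi> \<and> lrel_wf \<phi>"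

fun lrel_free :: "('a, 'p) lrel \<Rightarrow> nat set" where
  "lrel_free (LAtom A) = {}"
| "lrel_free (LVar Z) = {Z}"
| "lrel_free (LNot \<phi>) = lrel_free \<phi>"
| "lrel_free (LOr \<phi>1 \<phi>2) = lrel_free \<phi>1 \<union> lrel_free \<phi>2"
| "lrel_free (LDia K \<phi>) = lrel_free \<phi>"
| "lrel_free (LEx \<phi>1 \<phi>2) = lrel_free \<phi>1 \<union> lrel_free \<phi>2"
| "lrel_free (LFreeze z \<phi>) = lrel_free \<phi>"
| "lrel_free (LMu Y \<phi>) = lrel_free \<phi> - {Y}"

text \<open>That the delay successor of \<open>q\<close> by \<open>d\<close> lies in a set means that it exists and
  lies in that set, both for the final delay and for the earlier ones.\<close>

fun lrel_sem ::
  "('l, 'a, 'p) ta \<Rightarrow> (nat \<Rightarrow> 'l state set) \<Rightarrow> ('a, 'p) lrel \<Rightarrow> 'l state set" where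
  "lrel_sem TA \<theta> (LAtom A) = {q \<in> ta_states TA. A \<in> ta_label TA q}"
| "lrel_sem TA \<theta> (LVar Y) = \<theta> Y"
| "lrel_sem TA \<theta> (LNot \<phi>) = ta_states TA - lrel_sem TA \<theta> \<phi>"
| "lrel_sem TA \<theta> (LOr \<phi>1 \<phi>2) = lrel_sem TA \<theta> \<phi>1 \<union> lrel_sem TA \<theta> \<phi>2"
| "lrel_sem TA \<theta> (LDia K \<phi>) =
     {q \<in> ta_states TA. \<exists>a \<in> K. \<exists>q'. ta_step TA q (Act a) q' \<and> q' \<in> lrel_sem TA \<theta> \<phi>}"
| "lrel_sem TA \<theta> (LEx \<phi>1 \<phi>2) =
     {q \<in> ta_states TA. \<exists>d \<ge> 0.
        (\<exists>q'. ta_step TA q (Delay d) q' \<and> q' \<in> lrel_sem TA \<theta> \<phi>2) \<and>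
        (\<forall>d'. 0 \<le> d' \<and> d' < d \<longrightarrow>
           (\<exists>q'. ta_step TA q (Delay d') q' \<and>
                 q' \<in> lrel_sem TA \<theta> \<phi>1 \<union> lrel_sem TA \<theta> \<phi>2))}"
| "lrel_sem TA \<theta> (LFreeze z \<phi>) = {q \<in> ta_states TA. freeze_state z q \<in> lrel_sem TA \<theta> \<phi>}"
| "lrel_sem TA \<theta> (LMu Y \<phi>) =
     \<Inter> {S. S \<subseteq> ta_states TA \<and> lrel_sem TA (\<theta>(Y := S)) \<phi> \<subseteq> S}"

definition LAnd :: "('a, 'p) lrel \<Rightarrow> ('a, 'p) lrel \<Rightarrow> ('a, 'p) lrel" where
  "LAnd \<phi>1 \<phi>2 = LNot (LOr (LNot \<phi>1) (LNot \<phi>2))"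

definition LBox :: "'a set \<Rightarrow> ('a, 'p) lrel \<Rightarrow> ('a, 'p) lrel" where
  "LBox K \<phi> = LNot (LDia K (LNot \<phi>))"

definition Lff :: "clock \<Rightarrow> ('a, 'p) lrel" where
  "Lff x = LAtom (Clk (Single x Lt 0))"

definition LAllRel :: "('a, 'p) lrel \<Rightarrow> ('a, 'p) lrel \<Rightarrow> ('a, 'p) lrel" where
  "LAllRel \<phi>1 \<phi>2 = LNot (LEx (LNot \<phi>1) (LNot \<phi>2))"

definition LAll :: "clock \<Rightarrow> ('a, 'p) lrel \<Rightarrow> ('a, 'p) lrel" where
  "LAll x \<gamma> = LAllRel (Lff x) \<gamma>"

definition LTS :: "clock \<Rightarrow> nat \<Rightarrow> ('a, 'p) lrel" where
  "LTS x z = LFreeze z (LAll x (LAtom (Clk (Single (FreezeClock z) Lt 1))))"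

definition Lau :: "clock \<Rightarrow> nat \<Rightarrow> ('a, 'p) lrel \<Rightarrow> ('a, 'p) lrel \<Rightarrow> ('a, 'p) lrel" where
  "Lau x z \<gamma>1 \<gamma>2 = LEx \<gamma>1 (LOr \<gamma>2 (LAnd (LTS x z) (LAll x \<gamma>1)))"

text \<open>Parameters: \<open>x\<close> is the clock of the constant formula \<open>ff = (x < 0)\<close>, \<open>z\<close> the freeze
  clock of the time-stop formula, \<open>X\<close> the bound propositional variable. Reusing \<open>X\<close> at every
  level is harmless since all translated subformulas are closed (\<open>lrel_free_emb_tn\<close>).\<close>

fun emb_tn :: "clock \<Rightarrow> nat \<Rightarrow> nat \<Rightarrow> 'p tctl \<Rightarrow> ('a, 'p) lrel" where
  "emb_tn x z X (TAtom A) = LAtom A"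
| "emb_tn x z X (TNot \<phi>) = LNot (emb_tn x z X \<phi>)"
| "emb_tn x z X (TOr \<phi>1 \<phi>2) = LOr (emb_tn x z X \<phi>1) (emb_tn x z X \<phi>2)"
| "emb_tn x z X (TEU \<phi>1 \<phi>2) =
     LMu X (LEx (emb_tn x z X \<phi>1)
       (LOr (emb_tn x z X \<phi>2) (LAnd (emb_tn x z X \<phi>1) (LDia UNIV (LVar X)))))"
| "emb_tn x z X (TAU \<phi>1 \<phi>2) =
     LMu X (Lau x z (LAnd (emb_tn x z X \<phi>1) (LBox UNIV (LVar X))) (emb_tn x z X \<phi>2))"
| "emb_tn x z X (TFreeze y \<phi>) = LFreeze y (emb_tn x z X \<phi>)"

lemmas lrel_abbrev_defs = LAnd_def LBox_def Lff_def LAllRel_def LAll_def LTS_def Lau_def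

lemma lrel_free_emb_tn: "lrel_free (emb_tn x z X \<phi>) = {}"
  by (induction \<phi>) (auto simp: lrel_abbrev_defs)

lemma lrel_parity_not_free: "Y \<notin> lrel_free \<phi> \<Longrightarrow> lrel_parity b Y \<phi>"
  by (induction \<phi> arbitrary: b) auto

lemma lrel_wf_emb_tn: "lrel_wf (emb_tn x z X \<phi>)"
  by (induction \<phi>)
    (auto simp: lrel_abbrev_defs lrel_free_emb_tn intro!: lrel_parity_not_free)

lemma lrel_sem_cong_free:
  "(\<And>Y. Y \<in> lrel_free \<phi> \<Longrightarrow> \<theta> Y = \<theta>' Y) \<Longrightarrow> lrel_sem TA \<theta> \<phi> = lrel_sem TA \<theta>' \<phi>"
proof (induction \<phi> arbitrary: \<theta> \<theta>')
  case (LMu Y \<phi>)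
  have "lrel_sem TA (\<theta>(Y := S)) \<phi> = lrel_sem TA (\<theta>'(Y := S)) \<phi>" for S
    by (rule LMu.IH) (use LMu.prems in auto)
  then show ?case by simp
next
  case (LOr \<phi>1 \<phi>2)
  have "lrel_sem TA \<theta> \<phi>1 = lrel_sem TA \<theta>' \<phi>1"
    by (rule LOr.IH(1)) (use LOr.prems in auto)
  moreover have "lrel_sem TA \<theta> \<phi>2 = lrel_sem TA \<theta>' \<phi>2"
    by (rule LOr.IH(2)) (use LOr.prems in auto)
  ultimately show ?case by simp
next
  case (LEx \<phi>1 \<phi>2)
  have "lrel_sem TA \<theta> \<phi>1 = lrel_sem TA \<theta>' \<phi>1"
    by (rule LEx.IH(1)) (use LEx.prems in auto)
  moreover have "lrel_sem TA \<theta> \<phi>2 = lrel_sem TA \<theta>' \<phi>2"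
    by (rule LEx.IH(2)) (use LEx.prems in auto)
  ultimately show ?case by simp
next
  case (LNot \<phi>)
  have "lrel_sem TA \<theta> \<phi> = lrel_sem TA \<theta>' \<phi>"
    by (rule LNot.IH) (use LNot.prems in auto)
  then show ?case by simp
next
  case (LDia K \<phi>)
  have "lrel_sem TA \<theta> \<phi> = lrel_sem TA \<theta>' \<phi>"
    by (rule LDia.IH) (use LDia.prems in auto)
  then show ?case by simp
next
  case (LFreeze z \<phi>)
  have "lrel_sem TA \<theta> \<phi> = lrel_sem TA \<theta>' \<phi>"
    by (rule LFreeze.IH) (use LFreeze.prems in auto)
  then show ?case by simp
qed auto

end

theory Submission
  imports Defs
begin

text \<open>Both until operators are shown to be the least prefixpoints that their translations
  denote. For \<open>E(\<phi>1 U \<phi>2)\<close> one prepends steps to runs and reads a witnessing run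
  backwards.

  For \<open>A(\<phi>1 U \<phi>2)\<close>, suppose that a state outside a prefixpoint satisfies it. Then it can delay
  and act into a state of the same kind without meeting \<open>\<phi>2\<close>; iterating this yields an execution
  with infinitely many actions, which is a run because of non-Zenoness, and which never meets
  \<open>\<phi>2\<close>. The single step needs the infimum of the delays leading to \<open>\<phi>2\<close>, and when this infimum is
  not attained it needs \<open>\<phi>2\<close> to hold on a whole interval to its right.

  That regularity replaces the region construction, which would fail here since the guards of
  infinitely many edges need not have a maximal constant. Read a clock value \<open>v x\<close> at time \<open>T\<close> as the
  reset time \<open>T - v x\<close>. An increasing bijection \<open>h\<close> of the time axis with \<open>h (t + 1) = h t + 1\<close>
  preserves all clock constraints, so applying it to the present and to all reset times is a
  bisimulation, and every formula is invariant under it. As a formula mentions finitely many clocks,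
  after any delay \<open>g\<close> some \<open>h\<close> fixes their reset times while moving the present freely inside a
  short interval to the right of \<open>g\<close>.\<close>

section \<open>Invariance under warps of the time axis\<close>

text \<open>Such a map is the lift to the line of an orientation-preserving homeomorphism of the
  circle of reals modulo 1.\<close>

definition warp :: "(real \<Rightarrow> real) \<Rightarrow> bool" where
  "warp h \<longleftrightarrow> strict_mono h \<and> surj h \<and> (\<forall>t. h (t + 1) = h t + 1)"

lemma warp_less_iff: "warp h \<Longrightarrow> h s < h t \<longleftrightarrow> s < t"
  and warp_le_iff: "warp h \<Longrightarrow> h s \<le> h t \<longleftrightarrow> s \<le> t"
  by (auto simp: warp_def strict_mono_less strict_mono_less_eq)

lemma warp_add_nat: "warp h \<Longrightarrow> h (t + real n) = h t + real n"
proof (induction n)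
  case (Suc n)
  have "h ((t + real n) + 1) = h (t + real n) + 1"
    using Suc.prems by (simp add: warp_def)
  then show ?case using Suc by (simp add: algebra_simps)
qed simp

lemma warp_inv:
  assumes "warp h"
  shows "warp (inv h)"
proof -
  have bij: "bij h"
    using assms by (auto simp: warp_def bij_def strict_mono_imp_inj_on)
  have 1: "inv h (h t) = t" "h (inv h t) = t" for t
    using bij by (auto simp: bij_def surj_f_inv_f)
  have "strict_mono (inv h)"
  proof (rule strict_monoI)
    fix s t :: real assume "s < t"
    then have "h (inv h s) < h (inv h t)" using 1 by simp
    then show "inv h s < inv h t" using warp_less_iff[OF assms] by simp
  qed
  moreover have "inv h (t + 1) = inv h t + 1" for t
  proof -
    have "h (inv h t + 1) = t + 1" using assms 1 by (simp add: warp_def)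
    then show ?thesis using 1 by metis
  qed
  moreover have "surj (inv h)" using bij by (metis bij_imp_bij_inv bij_def)
  ultimately show ?thesis by (simp add: warp_def)
qed

text \<open>Comparing \<open>h t - h s\<close> with \<open>c\<close> means comparing
  \<open>h t\<close> with \<open>h s + c = h (s + c)\<close>, and there monotonicity removes
  \<open>h\<close>.\<close>

lemma cmp_holds_warp:
  assumes "warp h"
  shows "cmp_holds r (h t - h s) (real c) \<longleftrightarrow> cmp_holds r (t - s) (real c)"
proof -
  have "h t < h s + real c \<longleftrightarrow> t < s + real c" "h t \<le> h s + real c \<longleftrightarrow> t \<le> s + real c"
    "h t > h s + real c \<longleftrightarrow> t > s + real c" "h t \<ge> h s + real c \<longleftrightarrow> t \<ge> s + real c"
    using assms by (metis warp_add_nat warp_less_iff warp_le_iff)+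
  then show ?thesis by (cases r) (auto simp: algebra_simps)
qed

text \<open>\<open>T\<close> is the present and \<open>T - v x\<close> the time at which
  \<open>x\<close> was last reset; \<open>w\<close> shows the clock values after \<open>h\<close>
  has moved both. Restricting to \<open>C\<close> means that a finite \<open>C\<close> leaves only
  finitely many reset times to control.\<close>

definition warps_to :: "clock set \<Rightarrow> (real \<Rightarrow> real) \<Rightarrow> real \<Rightarrow> valuation \<Rightarrow> valuation \<Rightarrow> bool" where
  "warps_to C h T v w \<longleftrightarrow> warp h \<and> (\<forall>x\<in>C. w x = h T - h (T - v x))"

text \<open>\<open>T\<close> is existentially quantified because a valuation does not record
  absolute time.\<close>

definition state_sim :: "('l, 'a, 'p) ta \<Rightarrow> clock set \<Rightarrow> 'l state \<Rightarrow> 'l state \<Rightarrow> bool" where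
  "state_sim TA C q q' \<longleftrightarrow> q \<in> ta_states TA \<and> q' \<in> ta_states TA \<and> fst q = fst q' \<and>
     (\<exists>h T. warps_to C h T (snd q) (snd q'))"

lemma warps_to_sym:
  assumes "warps_to C h T v w"
  shows "warps_to C (inv h) (h T) w v"
proof -
  have h: "warp h" using assms by (simp add: warps_to_def)
  then have "inv h (h t) = t" for t
    by (auto simp: warp_def strict_mono_imp_inj_on)
  then show ?thesis using assms warp_inv[OF h] by (auto simp: warps_to_def)
qed

text \<open>The two warps date the middle valuation \<open>w\<close> differently, at
  \<open>h T\<close> and at \<open>U\<close>; the translation by \<open>U - h T\<close> between them
  reconciles the dates.\<close>

lemma warps_to_trans:
  assumes "warps_to C h T v w" "warps_to C k U w u"
  shows "warps_to C (\<lambda>t. k (h t + (U - h T))) T v u"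
proof -
  have hk: "warp h" "warp k" using assms by (simp_all add: warps_to_def)
  have "surj (\<lambda>t. k (h t + (U - h T)))"
  proof (rule surjI)
    fix y
    obtain a where "k a = y" using hk(2) by (metis warp_def surjD)
    moreover obtain b where "h b = a - (U - h T)" using hk(1) by (metis warp_def surjD)
    ultimately have "\<exists>b. k (h b + (U - h T)) = y" by (metis diff_add_cancel)
    then show "k (h (SOME b. k (h b + (U - h T)) = y) + (U - h T)) = y" by (rule someI_ex)
  qed
  moreover have "strict_mono (\<lambda>t. k (h t + (U - h T)))"
    using hk by (auto simp: strict_mono_def warp_less_iff)
  moreover have "k (h (t + 1) + (U - h T)) = k (h t + (U - h T)) + 1" for t
  proof -
    have "k ((h t + (U - h T)) + 1) = k (h t + (U - h T)) + 1" "h (t + 1) = h t + 1"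
      using hk by (simp_all add: warp_def)
    then show ?thesis by (simp add: algebra_simps)
  qed
  ultimately have "warp (\<lambda>t. k (h t + (U - h T)))" by (simp add: warp_def)
  moreover have "u x = k (h T + (U - h T)) - k (h (T - v x) + (U - h T))" if "x \<in> C" for x
  proof -
    have "w x = h T - h (T - v x)" "u x = k U - k (U - w x)"
      using that assms by (auto simp: warps_to_def)
    moreover from this have "U - w x = h (T - v x) + (U - h T)" "h T + (U - h T) = U" by linarith+
    ultimately show ?thesis by simp
  qed
  ultimately show ?thesis by (simp add: warps_to_def)
qed

lemma state_sim_states: "state_sim TA C q q' \<Longrightarrow> q' \<in> ta_states TA"
  by (simp add: state_sim_def)

lemma state_sim_sym: "state_sim TA C q q' \<Longrightarrow> state_sim TA C q' q"
  unfolding state_sim_def by (metis warps_to_sym)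

lemma state_sim_trans: "state_sim TA C q q' \<Longrightarrow> state_sim TA C q' q'' \<Longrightarrow> state_sim TA C q q''"
  unfolding state_sim_def by (metis warps_to_trans)

fun atomic_clocks :: "atomic_constraint \<Rightarrow> clock set" where
  "atomic_clocks (Single x r c) = {x}"
| "atomic_clocks (Diff x y r c) = {x, y}"

text \<open>A clock value is the distance from its reset time to the present. In a difference of
  clocks the present cancels and the distance of two reset times remains, so both forms fall under
  \<open>cmp_holds_warp\<close>.\<close>

lemma sat_atomic_warps_to:
  assumes "warps_to C h T v w" "atomic_clocks g \<subseteq> C"
  shows "sat_atomic w g \<longleftrightarrow> sat_atomic v g"
proof (cases g)
  case (Single x r c)
  then have "w x = h T - h (T - v x)" using assms by (auto simp: warps_to_def)
  then show ?thesis
    using Single assms cmp_holds_warp[of h r T "T - v x" c] by (simp add: warps_to_def)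
next
  case (Diff x y r c)
  then have "w x - w y = h (T - v y) - h (T - v x)" using assms by (auto simp: warps_to_def)
  then show ?thesis
    using Diff assms cmp_holds_warp[of h r "T - v y" "T - v x" c] by (simp add: warps_to_def)
qed

lemma sat_constraint_warps_to:
  assumes "warps_to C h T v w" "constraint_over C g"
  shows "sat_constraint w g \<longleftrightarrow> sat_constraint v g"
  using assms(2)
proof (induction g)
  case (AtomC g)
  then have "atomic_clocks g \<subseteq> C" by (cases g) auto
  then show ?case using sat_atomic_warps_to[OF assms(1)] by simp
qed auto

lemma constraint_over_mono: "constraint_over C g \<Longrightarrow> C \<subseteq> D \<Longrightarrow> constraint_over D g"
  by (induction C g rule: constraint_over.induct) auto

text \<open>A delay moves only the present, so the matching delay on the warped side is the length
  of the image interval.\<close>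

lemma warps_to_shift:
  "warps_to C h T v w \<Longrightarrow> warps_to C h (T + d) (shift_val v d) (shift_val w (h (T + d) - h T))"
  by (auto simp: warps_to_def shift_val_def)

text \<open>A reset makes the reset time equal to the present, on both sides.\<close>

lemma warps_to_reset:
  "warps_to C h T v w \<Longrightarrow> warps_to C h T (reset_val v R) (reset_val w R)"
  by (auto simp: warps_to_def reset_val_def)

section \<open>Steps of the automaton along warps\<close>

lemma ta_step_source: "ta_step TA q a q' \<Longrightarrow> q \<in> ta_states TA"
  by (auto elim: ta_step.cases)

lemma ta_step_target:
  assumes "timed_automaton TA" "ta_step TA q a q'"
  shows "q' \<in> ta_states TA"
  using assms(2)
proof cases
  case (action l v a g R l')
  then have "l' \<in> ta_locs TA" using assms(1) by (fastforce simp: timed_automaton_def)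
  then show ?thesis using action by (auto simp: ta_states_def reset_val_def)
qed (auto simp: ta_states_def shift_val_def)

lemma ta_step_delay_iff:
  "ta_step TA (l, v) (Delay d) q' \<longleftrightarrow> (l, v) \<in> ta_states TA \<and> 0 \<le> d \<and>
     (\<forall>d'. 0 \<le> d' \<and> d' \<le> d \<longrightarrow> sat_constraint (shift_val v d') (ta_inv TA l)) \<and>
     q' = (l, shift_val v d)"
  by (auto elim: ta_step.cases intro: ta_step.delay)

lemma ta_step_delay_unique:
  "ta_step TA q (Delay d) q' \<Longrightarrow> ta_step TA q (Delay d) q'' \<Longrightarrow> q' = q''"
  by (cases q) (auto simp: ta_step_delay_iff)

lemma ta_step_delay_zero: "q \<in> ta_states TA \<Longrightarrow> ta_step TA q (Delay 0) q' \<longleftrightarrow> q' = q"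
  by (cases q) (auto simp: ta_step_delay_iff shift_val_def ta_states_def)

lemma ta_step_delay_le:
  "ta_step TA q (Delay d) q' \<Longrightarrow> 0 \<le> d' \<Longrightarrow> d' \<le> d \<Longrightarrow>
     ta_step TA q (Delay d') (fst q, shift_val (snd q) d')"
  by (cases q) (auto simp: ta_step_delay_iff)

lemma ta_step_delay_add:
  assumes "ta_step TA q (Delay d) q'" "ta_step TA q' (Delay e) q''"
  shows "ta_step TA q (Delay (d + e)) q''"
proof -
  obtain l v where q: "q = (l, v)" by force
  have *: "sat_constraint (shift_val v d') (ta_inv TA l)" if "0 \<le> d'" "d' \<le> d + e" for d'
  proof (cases "d' \<le> d")
    case False
    then have "sat_constraint (shift_val (shift_val v d) (d' - d)) (ta_inv TA l)"
      using assms that by (auto simp: q ta_step_delay_iff)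
    then show ?thesis by (simp add: shift_val_def)
  qed (use assms that in \<open>auto simp: q ta_step_delay_iff\<close>)
  have "(\<lambda>x. v x + d + e) = (\<lambda>x. v x + (d + e))" by (simp add: add.assoc)
  then show ?thesis using assms * by (auto simp: q ta_step_delay_iff shift_val_def)
qed

lemma ta_step_delay_diff:
  assumes "ta_step TA q (Delay d) q'" "ta_step TA q (Delay e) q''" "d \<le> e"
    "timed_automaton TA"
  shows "ta_step TA q' (Delay (e - d)) q''"
proof -
  obtain l v where q: "q = (l, v)" by force
  have "shift_val (shift_val v d) d' = shift_val v (d + d')" for d'
    by (simp add: shift_val_def add.assoc)
  then show ?thesis
    using assms ta_step_target[OF assms(4,1)] by (auto simp: q ta_step_delay_iff)
qed

lemma invariant_over:
  assumes "timed_automaton TA" "(l, v) \<in> ta_states TA" "ta_clks TA \<subseteq> C"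
  shows "constraint_over C (ta_inv TA l)"
  using assms by (auto simp: timed_automaton_def ta_states_def intro: constraint_over_mono)

lemma ta_step_delay_warps_to:
  assumes TA: "timed_automaton TA" and C: "ta_clks TA \<subseteq> C"
    and w: "warps_to C h T v w" "(l, w) \<in> ta_states TA"
    and step: "ta_step TA (l, v) (Delay d) (l, v')"
  shows "ta_step TA (l, w) (Delay (h (T + d) - h T)) (l, shift_val w (h (T + d) - h T))"
    and "state_sim TA C (l, v') (l, shift_val w (h (T + d) - h T))"
proof -
  have h: "warp h" using w by (simp add: warps_to_def)
  have d: "0 \<le> d" "v' = shift_val v d" using step by (auto simp: ta_step_delay_iff)
  have "sat_constraint (shift_val w e) (ta_inv TA l)" if e: "0 \<le> e" "e \<le> h (T + d) - h T" for e
  proof -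
    \<comment> \<open>Each intermediate moment on the warped side is the image of a moment
      \<open>t\<close> during the given delay, where the invariant is known.\<close>
    obtain t where t: "h t = h T + e" using h by (metis warp_def surjD)
    then have "T \<le> t" "t \<le> T + d" using e warp_le_iff[OF h] by (smt (verit))+
    then have "sat_constraint (shift_val v (t - T)) (ta_inv TA l)"
      using step by (auto simp: ta_step_delay_iff)
    moreover have "warps_to C h t (shift_val v (t - T)) (shift_val w e)"
      using warps_to_shift[OF w(1), of "t - T"] t by simp
    ultimately show ?thesis
      using sat_constraint_warps_to invariant_over[OF TA w(2) C] by blast
  qed
  moreover have "0 \<le> h (T + d) - h T" using d warp_le_iff[OF h] by simp
  ultimately show "ta_step TA (l, w) (Delay (h (T + d) - h T)) (l, shift_val w (h (T + d) - h T))"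
    using w(2) by (auto simp: ta_step_delay_iff)
  then show "state_sim TA C (l, v') (l, shift_val w (h (T + d) - h T))"
    using ta_step_target[OF TA] step warps_to_shift[OF w(1), of d]
    by (fastforce simp: state_sim_def d)
qed

text \<open>The same edge can be taken: its guard and target invariant mention only clocks of
  \<open>C\<close>, so warping does not change their truth.\<close>

lemma ta_step_act_state_sim:
  assumes TA: "timed_automaton TA" and C: "ta_clks TA \<subseteq> C"
    and sim: "state_sim TA C q q'" and step: "ta_step TA q (Act a) q1"
  obtains q1' where "ta_step TA q' (Act a) q1'" "state_sim TA C q1 q1'"
proof -
  from step obtain l v g R l' where q: "q = (l, v)" "q1 = (l', reset_val v R)"
    and e: "(l, a, g, R, l') \<in> ta_edges TA" "sat_constraint v g"
      "sat_constraint (reset_val v R) (ta_inv TA l')"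
    by (auto elim: ta_step.cases)
  obtain w h T where w: "q' = (l, w)" "warps_to C h T v w" "(l, w) \<in> ta_states TA"
    using sim by (cases q') (auto simp: state_sim_def q)
  have "constraint_over (ta_clks TA) g" "l' \<in> ta_locs TA"
    using TA e(1) by (fastforce simp: timed_automaton_def)+
  then have g: "constraint_over C g" "constraint_over C (ta_inv TA l')"
    using C TA by (auto simp: timed_automaton_def intro: constraint_over_mono)
  have "ta_step TA q' (Act a) (l', reset_val w R)"
    using w e g sat_constraint_warps_to[OF w(2)] sat_constraint_warps_to[OF warps_to_reset[OF w(2)]]
    by (auto intro: ta_step.action)
  moreover from this have "state_sim TA C q1 (l', reset_val w R)"
    using ta_step_target[OF TA step] ta_step_target[OF TA] warps_to_reset[OF w(2), of R]
    unfolding state_sim_def q fst_conv snd_conv by blast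
  ultimately show ?thesis using that by blast
qed

lemma sat_constraint_cong:
  "constraint_over C g \<Longrightarrow> (\<And>x. x \<in> C \<Longrightarrow> v x = w x) \<Longrightarrow> sat_constraint v g = sat_constraint w g"
  by (induction C g rule: constraint_over.induct) auto

text \<open>Invariants speak about automaton clocks only, which resetting a freeze clock leaves
  untouched.\<close>

lemma sat_invariant_freeze:
  assumes "timed_automaton TA" "l \<in> ta_locs TA"
  shows "sat_constraint (shift_val (reset_val v {FreezeClock y}) d) (ta_inv TA l) \<longleftrightarrow>
    sat_constraint (shift_val v d) (ta_inv TA l)"
  by (rule sat_constraint_cong[of "ta_clks TA"])
    (use assms in \<open>auto simp: timed_automaton_def reset_val_def shift_val_def\<close>)

lemma freeze_state_in_states:
  assumes "timed_automaton TA" "q \<in> ta_states TA"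
  shows "freeze_state y q \<in> ta_states TA"
  using assms sat_invariant_freeze[OF assms(1), of "fst q" "snd q" y 0]
  by (cases q) (auto simp: ta_states_def freeze_state_def shift_val_def reset_val_def)

lemma state_sim_freeze:
  assumes "timed_automaton TA" "state_sim TA C q q'"
  shows "state_sim TA C (freeze_state y q) (freeze_state y q')"
proof -
  obtain h T where "warps_to C h T (snd q) (snd q')" using assms(2) by (auto simp: state_sim_def)
  then have "\<exists>h T. warps_to C h T (snd (freeze_state y q)) (snd (freeze_state y q'))"
    unfolding freeze_state_def snd_conv using warps_to_reset by blast
  moreover have "freeze_state y q \<in> ta_states TA" "freeze_state y q' \<in> ta_states TA"
    "fst (freeze_state y q) = fst (freeze_state y q')"
    using assms(2) freeze_state_in_states[OF assms(1)]
    by (simp_all add: state_sim_def) (simp add: freeze_state_def)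
  ultimately show ?thesis unfolding state_sim_def by blast
qed

section \<open>Invariance of the formula semantics under warps\<close>

definition sim_closed :: "('l, 'a, 'p) ta \<Rightarrow> clock set \<Rightarrow> 'l state set \<Rightarrow> bool" where
  "sim_closed TA C S \<longleftrightarrow> (\<forall>q q'. q \<in> S \<longrightarrow> state_sim TA C q q' \<longrightarrow> q' \<in> S)"

fun atom_clocks :: "'p atom \<Rightarrow> clock set" where
  "atom_clocks (Prop p) = {}"
| "atom_clocks (Clk g) = atomic_clocks g"

text \<open>Only clocks tested by atoms are collected: the resets of \<open>LFreeze\<close> respect
  warps whatever \<open>C\<close> is.\<close>

fun lrel_clocks :: "('a, 'p) lrel \<Rightarrow> clock set" where
  "lrel_clocks (LAtom A) = atom_clocks A"
| "lrel_clocks (LVar Z) = {}"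
| "lrel_clocks (LNot \<phi>) = lrel_clocks \<phi>"
| "lrel_clocks (LOr \<phi>1 \<phi>2) = lrel_clocks \<phi>1 \<union> lrel_clocks \<phi>2"
| "lrel_clocks (LDia K \<phi>) = lrel_clocks \<phi>"
| "lrel_clocks (LEx \<phi>1 \<phi>2) = lrel_clocks \<phi>1 \<union> lrel_clocks \<phi>2"
| "lrel_clocks (LFreeze z \<phi>) = lrel_clocks \<phi>"
| "lrel_clocks (LMu Y \<phi>) = lrel_clocks \<phi>"

lemma finite_lrel_clocks: "finite (lrel_clocks \<phi>)"
proof (induction \<phi>)
  case (LAtom A)
  then show ?case
  proof (cases A)
    case (Clk g)
    then show ?thesis by (cases g) auto
  qed simp
qed auto

lemma lrel_sem_subset_states:
  "(\<And>Y. \<theta> Y \<subseteq> ta_states TA) \<Longrightarrow> lrel_sem TA \<theta> \<phi> \<subseteq> ta_states TA"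
proof (induction \<phi> arbitrary: \<theta>)
  case (LMu Y \<phi>)
  have "lrel_sem TA (\<theta>(Y := ta_states TA)) \<phi> \<subseteq> ta_states TA"
    by (rule LMu.IH) (use LMu.prems in auto)
  then show ?case by auto
next
  case (LOr \<phi>1 \<phi>2)
  then show ?case by (metis Un_least lrel_sem.simps(4))
qed auto

lemma lrel_sem_mono_parity:
  "lrel_parity b Y \<phi> \<Longrightarrow> (if b then S \<subseteq> S' else S' \<subseteq> S) \<Longrightarrow>
    lrel_sem TA (\<theta>(Y := S)) \<phi> \<subseteq> lrel_sem TA (\<theta>(Y := S')) \<phi>"
proof (induction \<phi> arbitrary: b \<theta> S S')
  case (LVar Z)
  then show ?case by (simp split: if_splits)
next
  case (LNot \<phi>)
  have "lrel_sem TA (\<theta>(Y := S')) \<phi> \<subseteq> lrel_sem TA (\<theta>(Y := S)) \<phi>"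
    by (rule LNot.IH[of "\<not> b"]) (use LNot.prems in \<open>simp_all split: if_splits\<close>)
  then show ?case unfolding lrel_sem.simps by blast
next
  case (LOr \<phi>1 \<phi>2)
  then have "lrel_sem TA (\<theta>(Y := S)) \<phi>1 \<subseteq> lrel_sem TA (\<theta>(Y := S')) \<phi>1"
    "lrel_sem TA (\<theta>(Y := S)) \<phi>2 \<subseteq> lrel_sem TA (\<theta>(Y := S')) \<phi>2"
    unfolding lrel_parity.simps by blast+
  then show ?case unfolding lrel_sem.simps by blast
next
  case (LDia K \<phi>)
  then have "lrel_sem TA (\<theta>(Y := S)) \<phi> \<subseteq> lrel_sem TA (\<theta>(Y := S')) \<phi>"
    unfolding lrel_parity.simps by blast
  then show ?case unfolding lrel_sem.simps by blast
next
  case (LEx \<phi>1 \<phi>2)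
  then have "lrel_sem TA (\<theta>(Y := S)) \<phi>1 \<subseteq> lrel_sem TA (\<theta>(Y := S')) \<phi>1"
    "lrel_sem TA (\<theta>(Y := S)) \<phi>2 \<subseteq> lrel_sem TA (\<theta>(Y := S')) \<phi>2"
    unfolding lrel_parity.simps by blast+
  then show ?case unfolding lrel_sem.simps by (smt (verit) Collect_mono Un_iff subsetD)
next
  case (LFreeze z \<phi>)
  then have "lrel_sem TA (\<theta>(Y := S)) \<phi> \<subseteq> lrel_sem TA (\<theta>(Y := S')) \<phi>"
    unfolding lrel_parity.simps by blast
  then show ?case unfolding lrel_sem.simps by blast
next
  case (LMu Z \<phi>)
  show ?case
  proof (cases "Z = Y")
    case False
    then have "lrel_sem TA (\<theta>(Z := U, Y := S)) \<phi> \<subseteq> lrel_sem TA (\<theta>(Z := U, Y := S')) \<phi>" for U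
      using LMu unfolding lrel_parity.simps by blast
    then show ?thesis
      unfolding lrel_sem.simps fun_upd_twist[OF False[symmetric]] by blast
  next
    case True
    then show ?thesis unfolding lrel_sem.simps by (simp only: fun_upd_upd subset_refl)
  qed
qed simp

text \<open>Bisimulation invariance: actions are matched along the same edge and delays along their
  warped lengths, while symmetry of the relation handles negation.\<close>

lemma sim_closed_lrel_sem:
  assumes TA: "timed_automaton TA" and C: "ta_clks TA \<subseteq> C"
  shows "lrel_wf \<phi> \<Longrightarrow> lrel_clocks \<phi> \<subseteq> C \<Longrightarrow> (\<And>Y. \<theta> Y \<subseteq> ta_states TA) \<Longrightarrow>
    (\<And>Y. sim_closed TA C (\<theta> Y)) \<Longrightarrow> sim_closed TA C (lrel_sem TA \<theta> \<phi>)"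
proof (induction \<phi> arbitrary: \<theta>)
  case (LAtom A)
  have "A \<in> ta_label TA q'" if sim: "state_sim TA C q q'" and A: "A \<in> ta_label TA q" for q q'
  proof -
    obtain l v w h T where q: "q = (l, v)" "q' = (l, w)" "warps_to C h T v w"
      using sim by (cases q; cases q') (auto simp: state_sim_def)
    show ?thesis using A LAtom sat_atomic_warps_to[OF q(3)] by (cases A) (auto simp: q)
  qed
  then show ?case using state_sim_states by (fastforce simp: sim_closed_def)
next
  case (LVar Y)
  then show ?case by simp
next
  case (LNot \<phi>)
  then have "sim_closed TA C (lrel_sem TA \<theta> \<phi>)" by simp
  then show ?case
    using state_sim_states state_sim_sym unfolding sim_closed_def lrel_sem.simps by (metis Diff_iff)
next
  case (LOr \<phi>1 \<phi>2)
  then have "sim_closed TA C (lrel_sem TA \<theta> \<phi>1)" "sim_closed TA C (lrel_sem TA \<theta> \<phi>2)" by simp_all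
  then show ?case by (auto simp: sim_closed_def)
next
  case (LDia K \<phi>)
  then have *: "sim_closed TA C (lrel_sem TA \<theta> \<phi>)" by simp
  show ?case unfolding sim_closed_def
  proof (intro allI impI)
    fix q q' assume "q \<in> lrel_sem TA \<theta> (LDia K \<phi>)" and sim: "state_sim TA C q q'"
    then obtain a q1 where a: "a \<in> K" "ta_step TA q (Act a) q1" "q1 \<in> lrel_sem TA \<theta> \<phi>" by auto
    from ta_step_act_state_sim[OF TA C sim a(2)] obtain q1'
      where "ta_step TA q' (Act a) q1'" "state_sim TA C q1 q1'" .
    then show "q' \<in> lrel_sem TA \<theta> (LDia K \<phi>)"
      using a * state_sim_states[OF sim] unfolding sim_closed_def lrel_sem.simps by blast
  qed
next
  case (LEx \<phi>1 \<phi>2)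
  let ?S1 = "lrel_sem TA \<theta> \<phi>1" and ?S2 = "lrel_sem TA \<theta> \<phi>2"
  have *: "sim_closed TA C ?S1" "sim_closed TA C ?S2" using LEx by simp_all
  show ?case unfolding sim_closed_def
  proof (intro allI impI)
    fix q q' assume q: "q \<in> lrel_sem TA \<theta> (LEx \<phi>1 \<phi>2)" and sim: "state_sim TA C q q'"
    obtain l v w h T where l: "q = (l, v)" "q' = (l, w)" and w: "warps_to C h T v w"
      "(l, w) \<in> ta_states TA"
      using sim by (cases q; cases q') (auto simp: state_sim_def)
    have h: "warp h" using w by (simp add: warps_to_def)
    let ?d = "\<lambda>d. h (T + d) - h T"
    from q obtain d q1 where d: "d \<ge> 0" "ta_step TA q (Delay d) q1" "q1 \<in> ?S2"
      and less: "\<And>d'. 0 \<le> d' \<Longrightarrow> d' < d \<Longrightarrow> \<exists>q'. ta_step TA q (Delay d') q' \<and> q' \<in> ?S1 \<union> ?S2"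
      by auto
    have move: "\<exists>q2. ta_step TA q' (Delay (?d e)) q2 \<and> state_sim TA C q1 q2"
      if "ta_step TA q (Delay e) q1" for e q1
      using ta_step_delay_warps_to[OF TA C w, of e "snd q1"] that
      by (auto simp: l ta_step_delay_iff)
    have "?d d \<ge> 0" using d(1) warp_le_iff[OF h] by simp
    moreover have "\<exists>q2. ta_step TA q' (Delay (?d d)) q2 \<and> q2 \<in> ?S2"
      using move[OF d(2)] d(3) *(2) unfolding sim_closed_def by blast
    moreover have "\<exists>q2. ta_step TA q' (Delay e) q2 \<and> q2 \<in> ?S1 \<union> ?S2" if e: "0 \<le> e" "e < ?d d" for e
    proof -
      \<comment> \<open>The delay \<open>e\<close> on the warped side comes from the delay
        \<open>t - T\<close>, which is again shorter than \<open>d\<close>.\<close>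
      obtain t where t: "h t = h T + e" using h by (metis warp_def surjD)
      then have "0 \<le> t - T" "t - T < d"
        using e warp_le_iff[OF h, of T t] warp_less_iff[OF h, of t "T + d"] by auto
      from less[OF this] obtain q1 where "ta_step TA q (Delay (t - T)) q1" "q1 \<in> ?S1 \<union> ?S2" by auto
      moreover have "?d (t - T) = e" using t by simp
      ultimately show ?thesis using move[of "t - T" q1] * unfolding sim_closed_def by (metis Un_iff)
    qed
    ultimately show "q' \<in> lrel_sem TA \<theta> (LEx \<phi>1 \<phi>2)"
      using w(2) unfolding l(2) lrel_sem.simps by blast
  qed
next
  case (LFreeze z \<phi>)
  then have "sim_closed TA C (lrel_sem TA \<theta> \<phi>)" by simp
  then show ?case
    using state_sim_freeze[OF TA] state_sim_states
    unfolding sim_closed_def lrel_sem.simps mem_Collect_eq by metis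
next
  case (LMu Y \<phi>)
  define F where "F S = lrel_sem TA (\<theta>(Y := S)) \<phi>" for S
  define M where "M = lrel_sem TA \<theta> (LMu Y \<phi>)"
  have M: "M = \<Inter> {S. S \<subseteq> ta_states TA \<and> F S \<subseteq> S}" by (simp add: M_def F_def)
  have mono: "F S \<subseteq> F S'" if "S \<subseteq> S'" for S S'
    unfolding F_def by (rule lrel_sem_mono_parity[of True]) (use that LMu.prems(1) in simp_all)
  have sub: "M \<subseteq> ta_states TA"
    unfolding M_def by (rule lrel_sem_subset_states) (use LMu in auto)
  have lower: "M \<subseteq> S" if "S \<subseteq> ta_states TA" "F S \<subseteq> S" for S
    unfolding M by (rule Inter_lower) (use that in simp)
  \<comment> \<open>Half of the Knaster-Tarski argument: monotonicity, which rests on the positivity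
    of \<open>Y\<close>, makes \<open>M\<close> itself a prefixpoint.\<close>
  have "F M \<subseteq> M"
  proof (subst (2) M, rule Inter_greatest)
    fix S assume S: "S \<in> {S. S \<subseteq> ta_states TA \<and> F S \<subseteq> S}"
    then have "F M \<subseteq> F S" by (intro mono lower) simp_all
    then show "F M \<subseteq> S" using S by (simp only: mem_Collect_eq) (metis subset_trans)
  qed
  \<comment> \<open>The largest closed subset of the least fixpoint is again a prefixpoint.\<close>
  define N where "N = {q \<in> M. \<forall>q'. state_sim TA C q q' \<longrightarrow> q' \<in> M}"
  have N: "N \<subseteq> M" "sim_closed TA C N"
    unfolding N_def sim_closed_def using state_sim_trans by blast+
  have "sim_closed TA C (F N)"
    unfolding F_def by (rule LMu.IH) (use LMu.prems N sub in auto)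
  moreover have "F N \<subseteq> M" using mono[OF N(1)] \<open>F M \<subseteq> M\<close> by simp
  \<comment> \<open>\<open>N\<close> contains every closed subset of \<open>M\<close>, in particular
    \<open>F N\<close>; minimality of \<open>M\<close> then forces \<open>M = N\<close>.\<close>
  ultimately have "F N \<subseteq> N" unfolding N_def sim_closed_def by blast
  then have "M \<subseteq> N" using lower N(1) sub by simp
  then show ?case using N by (simp add: M_def subset_antisym)
qed

section \<open>Warps that move the present and fix given reset times\<close>

lemma warp_frac:
  assumes mono: "strict_mono_on {0..<1} k" and img: "k ` {0..<1} = {0..<1}"
  shows "warp (\<lambda>t. of_int \<lfloor>t\<rfloor> + k (frac t))"
proof -
  have fr: "frac t \<in> {0..<1}" for t :: real by (simp add: frac_lt_1)
  have k: "0 \<le> k (frac t)" "k (frac t) < 1" for t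
    using imageI[OF fr[of t], of k] unfolding img by simp_all
  let ?h = "\<lambda>t. of_int \<lfloor>t\<rfloor> + k (frac t)"
  have "strict_mono ?h"
  proof (rule strict_monoI)
    fix s t :: real assume "s < t"
    show "?h s < ?h t"
    proof (cases "\<lfloor>s\<rfloor> = \<lfloor>t\<rfloor>")
      case True
      then have "frac s < frac t" using \<open>s < t\<close> by (simp add: frac_def)
      then have "k (frac s) < k (frac t)" using mono fr by (simp add: strict_mono_on_def)
      then show ?thesis using True by simp
    next
      case False
      \<comment> \<open>A whole unit between the floors outweighs the values of \<open>k\<close>,
        which differ by less than 1.\<close>
      then have "\<lfloor>s\<rfloor> + 1 \<le> \<lfloor>t\<rfloor>" using \<open>s < t\<close> by linarith
      then have "real_of_int \<lfloor>s\<rfloor> + 1 \<le> real_of_int \<lfloor>t\<rfloor>" by linarith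
      then show ?thesis using k[of s] k[of t] by linarith
    qed
  qed
  moreover have "\<exists>t. y = ?h t" for y
  proof -
    obtain s where s: "s \<in> {0..<1}" "k s = frac y" using img fr[of y] by (metis imageE)
    then have "\<lfloor>of_int \<lfloor>y\<rfloor> + s\<rfloor> = \<lfloor>y\<rfloor>" "frac (of_int \<lfloor>y\<rfloor> + s) = s"
      by (auto simp: floor_unique frac_def floor_eq_iff)
    then have "y = ?h (of_int \<lfloor>y\<rfloor> + s)" using s by (simp add: frac_def)
    then show ?thesis ..
  qed
  then have "surj ?h" by (simp add: surj_def)
  moreover have "?h (t + 1) = ?h t + 1" for t
    by (simp add: frac_def)
  ultimately show ?thesis by (simp add: warp_def)
qed

text \<open>Conjugation with a translation lets the periodic pattern start at
  \<open>g\<close>.\<close>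

lemma warp_translate: "warp h \<Longrightarrow> warp (\<lambda>t. g + h (t - g))"
proof -
  assume h: "warp h"
  have "\<exists>t. y = g + h (t - g)" for y
  proof -
    obtain s where "h s = y - g" using h by (metis warp_def surjD)
    then have "y = g + h ((s + g) - g)" by simp
    then show ?thesis ..
  qed
  moreover have "g + h (t + 1 - g) = g + h (t - g) + 1" for t
  proof -
    have "h ((t - g) + 1) = h (t - g) + 1" using h by (simp add: warp_def)
    then show ?thesis by (simp add: algebra_simps)
  qed
  ultimately show ?thesis
    using h by (auto simp: warp_def strict_mono_def surj_def)
qed

text \<open>A rescaled power function glued to the identity. It fixes 0 and every point from
  \<open>\<epsilon>\<close> on, while varying \<open>p\<close> carries any point strictly between 0
  and \<open>\<epsilon>\<close> to any other.\<close>

definition powr_bump :: "real \<Rightarrow> real \<Rightarrow> real \<Rightarrow> real" where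
  "powr_bump \<epsilon> p s = (if s < \<epsilon> then \<epsilon> * (s / \<epsilon>) powr p else s)"

lemma powr_bump_less:
  assumes "0 < \<epsilon>" "0 < p" "0 \<le> s" "s < \<epsilon>"
  shows "powr_bump \<epsilon> p s < \<epsilon>"
proof -
  have "(s / \<epsilon>) powr p < 1 powr p" by (rule powr_less_mono2) (use assms in auto)
  then show ?thesis using assms by (simp add: powr_bump_def)
qed

lemma powr_bump_in:
  assumes "0 < \<epsilon>" "\<epsilon> \<le> 1" "0 < p" "s \<in> {0..<1}"
  shows "powr_bump \<epsilon> p s \<in> {0..<1}"
proof (cases "s < \<epsilon>")
  case True
  then have "powr_bump \<epsilon> p s < 1" using powr_bump_less[of \<epsilon> p s] assms by simp
  moreover have "0 \<le> powr_bump \<epsilon> p s" using True assms by (simp add: powr_bump_def)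
  ultimately show ?thesis by simp
qed (use assms in \<open>simp add: powr_bump_def\<close>)

text \<open>The reciprocal exponent inverts a bump; this supplies surjectivity onto the unit
  interval.\<close>

lemma powr_bump_inverse:
  assumes "0 < \<epsilon>" "0 < p" "0 \<le> s"
  shows "powr_bump \<epsilon> p (powr_bump \<epsilon> (1 / p) s) = s"
proof (cases "s < \<epsilon>")
  case True
  then have "powr_bump \<epsilon> (1 / p) s < \<epsilon>" using powr_bump_less[of \<epsilon> "1 / p" s] assms by simp
  then have "powr_bump \<epsilon> p (powr_bump \<epsilon> (1 / p) s) = \<epsilon> * ((s / \<epsilon>) powr (1 / p)) powr p"
    using True assms by (simp add: powr_bump_def)
  also have "\<dots> = s" using assms by (simp add: powr_powr)
  finally show ?thesis .
qed (simp add: powr_bump_def)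

lemma strict_mono_on_powr_bump:
  assumes "0 < \<epsilon>" "0 < p"
  shows "strict_mono_on {0..<1} (powr_bump \<epsilon> p)"
proof (rule strict_mono_onI)
  fix s t :: real assume st: "s \<in> {0..<1}" "t \<in> {0..<1}" "s < t"
  show "powr_bump \<epsilon> p s < powr_bump \<epsilon> p t"
  proof (cases "t < \<epsilon>")
    case True
    have "(s / \<epsilon>) powr p < (t / \<epsilon>) powr p"
      by (rule powr_less_mono2) (use st assms in \<open>auto simp: divide_strict_right_mono\<close>)
    then show ?thesis using True st assms by (simp add: powr_bump_def)
  next
    case False
    have "powr_bump \<epsilon> p s < t"
    proof (cases "s < \<epsilon>")
      case True
      then have "powr_bump \<epsilon> p s < \<epsilon>" using powr_bump_less[of \<epsilon> p s] st assms by simp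
      then show ?thesis using False by simp
    qed (use st in \<open>simp add: powr_bump_def\<close>)
    then show ?thesis using False by (simp add: powr_bump_def[of _ _ t])
  qed
qed

lemma warp_powr_bump:
  assumes "0 < \<epsilon>" "\<epsilon> \<le> 1" "0 < p"
  shows "warp (\<lambda>t. of_int \<lfloor>t\<rfloor> + powr_bump \<epsilon> p (frac t))"
proof (rule warp_frac)
  have "t \<in> powr_bump \<epsilon> p ` {0..<1}" if "t \<in> {0..<1}" for t
    using powr_bump_inverse[of \<epsilon> p t] powr_bump_in[of \<epsilon> "1 / p" t] that assms
    by (intro image_eqI[of _ _ "powr_bump \<epsilon> (1 / p) t"]) auto
  then show "powr_bump \<epsilon> p ` {0..<1} = {0..<1}" using powr_bump_in assms by blast
qed (use assms strict_mono_on_powr_bump in blast)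

text \<open>With the present dated \<open>d\<close>, the reset times are \<open>- v x\<close>. Those
  congruent to \<open>g\<close> modulo 1 start a period and are fixed by the bump; the others have
  an offset of at least \<open>\<epsilon>\<close> and are fixed as well. So the present can move
  alone.\<close>

lemma shift_right_warps_to:
  assumes "finite C"
  obtains \<epsilon> where "0 < \<epsilon>"
    "\<And>d d'. g < d \<Longrightarrow> d < g + \<epsilon> \<Longrightarrow> g < d' \<Longrightarrow> d' < g + \<epsilon> \<Longrightarrow>
       \<exists>h T. warps_to C h T (shift_val v d) (shift_val v d')"
proof -
  \<comment> \<open>The smallest nonzero offset of a reset time modulo 1, measured upward from
    \<open>g\<close> and capped at 1.\<close>
  define \<epsilon> where "\<epsilon> = Min (insert 1 ((\<lambda>x. frac (- v x - g)) ` C - {0}))"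
  have fin: "finite (insert 1 ((\<lambda>x. frac (- v x - g)) ` C - {0}))" using assms by simp
  have \<epsilon>: "0 < \<epsilon>" "\<epsilon> \<le> 1" unfolding \<epsilon>_def
    using fin by (auto simp: order.not_eq_order_implies_strict)
  have reset: "frac (- v x - g) = 0 \<or> \<epsilon> \<le> frac (- v x - g)" if "x \<in> C" for x
    unfolding \<epsilon>_def using that fin by (auto intro!: Min_le)
  have "\<exists>h T. warps_to C h T (shift_val v d) (shift_val v d')"
    if d: "g < d" "d < g + \<epsilon>" "g < d'" "d' < g + \<epsilon>" for d d'
  proof -
    \<comment> \<open>The warp fixes every reset time \<open>- v x\<close> and moves the present \<open>d\<close> to \<open>d'\<close>.\<close>
    define a where "a = (d - g) / \<epsilon>"
    define b where "b = (d' - g) / \<epsilon>"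
    \<comment> \<open>The solution of \<open>a powr p = b\<close>; it is positive because both
      logarithms are negative.\<close>
    define p where "p = ln b / ln a"
    have ab: "0 < a" "a < 1" "0 < b" "b < 1" using d \<epsilon> by (auto simp: a_def b_def)
    then have p: "0 < p" by (simp add: p_def divide_neg_neg)
    have "a powr p = b" using ab by (simp add: powr_def p_def)
    define H where "H t = of_int \<lfloor>t\<rfloor> + powr_bump \<epsilon> p (frac t)" for t
    define h where "h t = g + H (t - g)" for t
    have "warp h"
      unfolding h_def[abs_def] H_def[abs_def] using warp_translate warp_powr_bump \<epsilon> p by blast
    moreover have "h (- v x) = - v x" if "x \<in> C" for x
    proof -
      have "powr_bump \<epsilon> p (frac (- v x - g)) = frac (- v x - g)"
        using reset[OF that] \<epsilon> by (auto simp: powr_bump_def simp del: frac_eq_0_iff)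
      then show ?thesis by (simp add: h_def H_def frac_def)
    qed
    moreover have "h d = d'"
    proof -
      have "\<lfloor>d - g\<rfloor> = 0" using d \<epsilon> by (simp add: floor_eq_iff)
      then have "H (d - g) = \<epsilon> * a powr p"
        using d by (simp add: H_def frac_def powr_bump_def a_def)
      then show ?thesis using \<open>a powr p = b\<close> \<epsilon> by (simp add: h_def b_def)
    qed
    ultimately have "warps_to C h d (shift_val v d) (shift_val v d')"
      by (simp add: warps_to_def shift_val_def)
    then show ?thesis by blast
  qed
  then show ?thesis using that \<epsilon>(1) by blast
qed

text \<open>The interval is open at \<open>g\<close>, since truth may change at \<open>g\<close>
  itself: \<open>x \<le> 1\<close> holds when \<open>x\<close> reaches 1 but not afterwards.\<close>

definition right_constant :: "('l, 'a, 'p) ta \<Rightarrow> 'l state set \<Rightarrow> bool" where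
  "right_constant TA P \<longleftrightarrow> (\<forall>q g. \<exists>\<epsilon>>0. \<forall>d1 d2 q1 q2.
     g < d1 \<and> d1 < g + \<epsilon> \<and> g < d2 \<and> d2 < g + \<epsilon> \<and>
     ta_step TA q (Delay d1) q1 \<and> ta_step TA q (Delay d2) q2 \<and> q1 \<in> P \<longrightarrow> q2 \<in> P)"

text \<open>Two delay successors of \<open>q\<close> shortly after \<open>g\<close> are warps of
  each other, hence both belong to \<open>P\<close> or neither does.\<close>

lemma right_constant_sim_closed:
  fixes TA :: "('l, 'a, 'p) ta"
  assumes TA: "timed_automaton TA" and C: "finite C" "sim_closed TA C P"
  shows "right_constant TA P"
  unfolding right_constant_def
proof (intro allI)
  fix q :: "'l state" and g :: real
  obtain l v where q: "q = (l, v)" by force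
  obtain \<epsilon> where \<epsilon>: "0 < \<epsilon>" "\<And>d d'. g < d \<Longrightarrow> d < g + \<epsilon> \<Longrightarrow> g < d' \<Longrightarrow> d' < g + \<epsilon> \<Longrightarrow>
       \<exists>h T. warps_to C h T (shift_val v d) (shift_val v d')"
    using shift_right_warps_to[OF C(1)] by blast
  have "q2 \<in> P" if "g < d1" "d1 < g + \<epsilon>" "g < d2" "d2 < g + \<epsilon>"
    and s: "ta_step TA q (Delay d1) q1" "ta_step TA q (Delay d2) q2" and "q1 \<in> P" for d1 d2 q1 q2
  proof -
    have "q1 = (l, shift_val v d1)" "q2 = (l, shift_val v d2)"
      using s by (simp_all add: q ta_step_delay_iff)
    then have "state_sim TA C q1 q2"
      using \<epsilon>(2)[of d1 d2] that s[THEN ta_step_target[OF TA]] by (simp add: state_sim_def)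
    then show ?thesis using C(2) \<open>q1 \<in> P\<close> unfolding sim_closed_def by blast
  qed
  then show "\<exists>\<epsilon>>0. \<forall>d1 d2 q1 q2.
     g < d1 \<and> d1 < g + \<epsilon> \<and> g < d2 \<and> d2 < g + \<epsilon> \<and>
     ta_step TA q (Delay d1) q1 \<and> ta_step TA q (Delay d2) q2 \<and> q1 \<in> P \<longrightarrow> q2 \<in> P"
    using \<epsilon>(1) by blast
qed

lemma right_constant_emb_tn:
  fixes TA :: "('l, 'a, 'p) ta"
  assumes TA: "timed_automaton TA"
  shows "right_constant TA (lrel_sem TA \<theta> (emb_tn x z X \<phi>))"
proof -
  let ?\<phi> = "emb_tn x z X \<phi> :: ('a, 'p) lrel"
  let ?C = "ta_clks TA \<union> lrel_clocks ?\<phi>"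
  \<comment> \<open>The formula is closed, so the arbitrary \<open>\<theta>\<close> can be exchanged
    for the empty environment, whose values are trivially closed under warps.\<close>
  have "lrel_sem TA \<theta> ?\<phi> = lrel_sem TA (\<lambda>_. {}) ?\<phi>"
    by (rule lrel_sem_cong_free) (simp add: lrel_free_emb_tn)
  moreover have "sim_closed TA ?C (lrel_sem TA (\<lambda>_. {}) ?\<phi>)"
    by (rule sim_closed_lrel_sem[OF TA]) (auto simp: lrel_wf_emb_tn sim_closed_def)
  moreover have "finite ?C" using TA finite_lrel_clocks by (auto simp: timed_automaton_def)
  ultimately show ?thesis using right_constant_sim_closed[OF TA] by metis
qed

section \<open>Runs and until paths\<close>

lemma positions_infinite:
  "ex_len \<rho> = \<infinity> \<Longrightarrow> (i, e) \<in> positions \<rho> \<longleftrightarrow>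
     e = 0 \<or> (\<exists>d. ex_label \<rho> i = Delay d \<and> 0 < e \<and> e < d)"
  by (auto simp: positions_def)

lemma ta_step_label_delay_nonneg: "ta_step TA q a q' \<Longrightarrow> 0 \<le> label_delay a"
  by (auto elim: ta_step.cases)

text \<open>Finitely many delays, each of finite length, cannot have infinite duration.\<close>

lemma run_from_infinite:
  assumes "run_from TA q \<rho>"
  shows "ex_len \<rho> = \<infinity>"
proof (rule ccontr)
  assume "ex_len \<rho> \<noteq> \<infinity>"
  then obtain n where n: "ex_len \<rho> = enat n" by auto
  have "duration \<rho> = (\<Sum>i<n. if enat i < ex_len \<rho> then ennreal (label_delay (ex_label \<rho> i)) else 0)"
    unfolding duration_def by (rule suminf_finite) (auto simp: n)
  also have "\<dots> < \<infinity>" by (simp add: n less_top[symmetric])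
  finally show False using assms by (simp add: run_from_def)
qed

lemma run_from_step:
  "run_from TA q \<rho> \<Longrightarrow> ta_step TA (ex_state \<rho> i) (ex_label \<rho> i) (ex_state \<rho> (Suc i))"
  using run_from_infinite[of TA q \<rho>] by (simp add: run_from_def execution_from_def)

lemma run_from_start: "run_from TA q \<rho> \<Longrightarrow> ex_state \<rho> 0 = q"
  by (simp add: run_from_def execution_from_def)

lemma run_from_unbounded:
  assumes "run_from TA q \<rho>"
  obtains n where "B \<le> (\<Sum>i<n. label_delay (ex_label \<rho> i))"
proof (rule ccontr)
  assume "\<not> thesis"
  with that have less: "(\<Sum>i<n. label_delay (ex_label \<rho> i)) \<le> B" for n by (meson linear)
  have "duration \<rho> = (\<Sum>i. ennreal (label_delay (ex_label \<rho> i)))"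
    using run_from_infinite[OF assms] by (simp add: duration_def)
  also have "\<dots> \<le> ennreal B"
  proof (rule suminf_le_const)
    fix n
    have "(\<Sum>i<n. ennreal (label_delay (ex_label \<rho> i))) = ennreal (\<Sum>i<n. label_delay (ex_label \<rho> i))"
      by (rule sum_ennreal) (use run_from_step[OF assms] ta_step_label_delay_nonneg in blast)
    then show "(\<Sum>i<n. ennreal (label_delay (ex_label \<rho> i))) \<le> ennreal B"
      using less by (simp add: ennreal_leI)
  qed simp
  finally show False using assms by (simp add: run_from_def top_unique)
qed

section \<open>Prepending a transition to an execution and dropping its beginning\<close>

definition ex_cons :: "'l state \<Rightarrow> 'a label \<Rightarrow> ('l, 'a) execution \<Rightarrow> ('l, 'a) execution" where
  "ex_cons q a \<rho> = \<lparr>ex_len = eSuc (ex_len \<rho>), ex_state = case_nat q (ex_state \<rho>),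
     ex_label = case_nat a (ex_label \<rho>)\<rparr>"

definition ex_drop :: "nat \<Rightarrow> ('l, 'a) execution \<Rightarrow> ('l, 'a) execution" where
  "ex_drop n \<rho> = \<lparr>ex_len = ex_len \<rho> - enat n, ex_state = (\<lambda>i. ex_state \<rho> (i + n)),
     ex_label = (\<lambda>i. ex_label \<rho> (i + n))\<rparr>"

lemma run_from_cons:
  assumes "ta_step TA q a q'" "run_from TA q' \<rho>"
  shows "run_from TA q (ex_cons q a \<rho>)"
proof -
  have len: "ex_len \<rho> = \<infinity>" using assms(2) by (rule run_from_infinite)
  have "ta_step TA (ex_state (ex_cons q a \<rho>) i) (ex_label (ex_cons q a \<rho>) i)
      (ex_state (ex_cons q a \<rho>) (Suc i))" for i
    using assms(1) run_from_step[OF assms(2)] run_from_start[OF assms(2)]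
    by (cases i) (auto simp: ex_cons_def)
  moreover have "duration (ex_cons q a \<rho>) = \<infinity>"
  proof -
    have "duration (ex_cons q a \<rho>) = (\<Sum>i. ennreal (label_delay (case_nat a (ex_label \<rho>) i)))"
      by (simp add: duration_def ex_cons_def len)
    also have "\<dots> = (\<Sum>i. ennreal (label_delay (ex_label \<rho> i))) + ennreal (label_delay a)"
      by (subst suminf_offset[of _ 1]) simp_all
    also have "\<dots> = \<infinity>" using assms(2) by (simp add: run_from_def duration_def len)
    finally show ?thesis .
  qed
  ultimately show ?thesis
    using ta_step_source[OF assms(1)] by (simp add: run_from_def execution_from_def) (simp add: ex_cons_def)
qed

text \<open>The removed transitions have finite total duration, so the remaining ones still
  diverge.\<close>

lemma run_from_drop:
  assumes TA: "timed_automaton TA" and run: "run_from TA q \<rho>"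
  shows "run_from TA (ex_state \<rho> n) (ex_drop n \<rho>)"
proof -
  have len: "ex_len \<rho> = \<infinity>" using run by (rule run_from_infinite)
  have "(\<Sum>i. ennreal (label_delay (ex_label \<rho> (i + n)))) = \<infinity>"
  proof (rule ccontr)
    assume "(\<Sum>i. ennreal (label_delay (ex_label \<rho> (i + n)))) \<noteq> \<infinity>"
    moreover have "duration \<rho> = (\<Sum>i. ennreal (label_delay (ex_label \<rho> (i + n)))) +
        (\<Sum>i<n. ennreal (label_delay (ex_label \<rho> i)))"
      unfolding duration_def len by (subst suminf_offset[of _ n]) simp_all
    moreover have "(\<Sum>i<n. ennreal (label_delay (ex_label \<rho> i))) < \<infinity>" by (simp add: less_top[symmetric])
    ultimately show False using run by (auto simp: run_from_def)
  qed
  moreover have "ex_state \<rho> n \<in> ta_states TA" using run_from_step[OF run] by (rule ta_step_source)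
  ultimately show ?thesis using run_from_step[OF run, of "_ + n"]
    by (auto simp: run_from_def execution_from_def ex_drop_def duration_def len)
qed

text \<open>The witnessing position cannot belong to the first transition and therefore lies in
  \<open>\<rho>\<close>. This passes an until condition on to a successor.\<close>

lemma until_path_cons_dest:
  assumes "until_path (ex_cons q a \<rho>) Q1 Q2" "ex_len \<rho> = \<infinity>"
    and "\<And>e. (0, e) \<in> positions (ex_cons q a \<rho>) \<Longrightarrow> position_state (ex_cons q a \<rho>) (0, e) \<notin> Q2"
  shows "until_path \<rho> Q1 Q2"
proof -
  have Suc: "(Suc i, e) \<in> positions (ex_cons q a \<rho>) \<longleftrightarrow> (i, e) \<in> positions \<rho>" for i e
    using assms(2) by (simp add: positions_infinite ex_cons_def)
  have state: "position_state (ex_cons q a \<rho>) (Suc i, e) = position_state \<rho> (i, e)" for i e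
    by (simp add: ex_cons_def)
  obtain j e where p: "(j, e) \<in> positions (ex_cons q a \<rho>)"
    "position_state (ex_cons q a \<rho>) (j, e) \<in> Q2"
    and less: "\<And>p'. p' \<in> positions (ex_cons q a \<rho>) \<Longrightarrow> position_less p' (j, e) \<Longrightarrow>
      position_state (ex_cons q a \<rho>) p' \<in> Q1"
    using assms(1) by (auto simp: until_path_def simp del: position_state.simps)
  obtain i where j: "j = Suc i" using assms(3) p by (cases j) blast+
  show ?thesis unfolding until_path_def
  proof (intro bexI conjI ballI impI)
    show "(i, e) \<in> positions \<rho>" using p Suc j by blast
    show "position_state \<rho> (i, e) \<in> Q2" using p state j by metis
    fix p' assume p': "p' \<in> positions \<rho>" "position_less p' (i, e)"
    obtain i' e' where "p' = (i', e')" by force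
    then show "position_state \<rho> p' \<in> Q1"
      using less[of "(Suc i', e')"] p' Suc state j by fastforce
  qed
qed

text \<open>The positions of the new transition precede all others, so it is enough that they lie in
  \<open>Q1\<close>.\<close>

lemma until_path_cons:
  assumes "until_path \<rho> Q1 Q2" "ex_len \<rho> = \<infinity>"
    and "\<And>e. (0, e) \<in> positions (ex_cons q a \<rho>) \<Longrightarrow> position_state (ex_cons q a \<rho>) (0, e) \<in> Q1"
  shows "until_path (ex_cons q a \<rho>) Q1 Q2"
proof -
  have Suc: "(Suc i, e) \<in> positions (ex_cons q a \<rho>) \<longleftrightarrow> (i, e) \<in> positions \<rho>" for i e
    using assms(2) by (simp add: positions_infinite ex_cons_def)
  have state: "position_state (ex_cons q a \<rho>) (Suc i, e) = position_state \<rho> (i, e)" for i e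
    by (simp add: ex_cons_def)
  obtain i e where p: "(i, e) \<in> positions \<rho>" "position_state \<rho> (i, e) \<in> Q2"
    and less: "\<And>p'. p' \<in> positions \<rho> \<Longrightarrow> position_less p' (i, e) \<Longrightarrow> position_state \<rho> p' \<in> Q1"
    using assms(1) by (auto simp: until_path_def simp del: position_state.simps)
  show ?thesis unfolding until_path_def
  proof (intro bexI conjI ballI impI)
    show "(Suc i, e) \<in> positions (ex_cons q a \<rho>)" using p Suc by blast
    show "position_state (ex_cons q a \<rho>) (Suc i, e) \<in> Q2" using p state by metis
    fix p' assume p': "p' \<in> positions (ex_cons q a \<rho>)" "position_less p' (Suc i, e)"
    obtain i' e' where [simp]: "p' = (i', e')" by force
    show "position_state (ex_cons q a \<rho>) p' \<in> Q1"
    proof (cases i')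
      case 0
      then show ?thesis using assms(3) p' by simp
    next
      case (Suc k)
      have "(k, e') \<in> positions \<rho>" "position_less (k, e') (i, e)"
        using p' Suc \<open>(Suc k, e') \<in> positions (ex_cons q a \<rho>) \<longleftrightarrow> (k, e') \<in> positions \<rho>\<close> by auto
      from less[OF this] show ?thesis using state[of k e'] Suc by simp
    qed
  qed
qed

lemma until_path_drop:
  assumes "until_path (ex_drop n \<rho>) Q1 Q2" "ex_len \<rho> = \<infinity>"
    and "\<And>i e. i < n \<Longrightarrow> (i, e) \<in> positions \<rho> \<Longrightarrow> position_state \<rho> (i, e) \<in> Q1"
  shows "until_path \<rho> Q1 Q2"
proof -
  have pos: "(i, e) \<in> positions (ex_drop n \<rho>) \<longleftrightarrow> (i + n, e) \<in> positions \<rho>" for i e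
    using assms(2) by (simp add: positions_infinite ex_drop_def)
  have state: "position_state (ex_drop n \<rho>) (i, e) = position_state \<rho> (i + n, e)" for i e
    by (simp add: ex_drop_def)
  obtain i e where p: "(i, e) \<in> positions (ex_drop n \<rho>)" "position_state (ex_drop n \<rho>) (i, e) \<in> Q2"
    and less: "\<And>p'. p' \<in> positions (ex_drop n \<rho>) \<Longrightarrow> position_less p' (i, e) \<Longrightarrow>
      position_state (ex_drop n \<rho>) p' \<in> Q1"
    using assms(1) by (auto simp: until_path_def simp del: position_state.simps)
  show ?thesis unfolding until_path_def
  proof (intro bexI conjI ballI impI)
    show "(i + n, e) \<in> positions \<rho>" using p pos by blast
    show "position_state \<rho> (i + n, e) \<in> Q2" using p state by metis
    fix p' assume p': "p' \<in> positions \<rho>" "position_less p' (i + n, e)"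
    obtain i' e' where [simp]: "p' = (i', e')" by force
    show "position_state \<rho> p' \<in> Q1"
    proof (cases "i' < n")
      case True
      then show ?thesis using assms(3) p' by simp
    next
      case False
      then obtain k where k: "i' = k + n" by (metis add.commute le_Suc_ex not_less)
      have "(k, e') \<in> positions (ex_drop n \<rho>)" "position_less (k, e') (i, e)"
        using p' k pos by auto
      from less[OF this] show ?thesis using state[of k e'] k by simp
    qed
  qed
qed

text \<open>This treats all positions as delay successors. If the transition is an action, only
  \<open>e = 0\<close> is a position, and the zero delay always exists.\<close>

lemma position_step:
  assumes "run_from TA q \<rho>" "(i, e) \<in> positions \<rho>"
  shows "ta_step TA (ex_state \<rho> i) (Delay e) (position_state \<rho> (i, e))"
proof (cases "e = 0")
  case True
  then show ?thesis
    using ta_step_delay_zero[of "ex_state \<rho> i" TA] ta_step_source[OF run_from_step[OF assms(1)]]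
    by (simp add: shift_val_def)
next
  case False
  then obtain d where "ex_label \<rho> i = Delay d" "0 < e" "e < d"
    using assms positions_infinite[OF run_from_infinite[OF assms(1)]] by auto
  then show ?thesis using ta_step_delay_le[of TA "ex_state \<rho> i" d _ e] run_from_step[OF assms(1), of i]
    by simp
qed

section \<open>Semantics of the modalities\<close>

text \<open>The earlier delays need no existence claim and no lower bound: delay steps are
  nonnegative and deterministic, and every shorter delay is possible too. Hence this agrees with
  \<open>LEx\<close>.\<close>

definition delay_until :: "('l, 'a, 'p) ta \<Rightarrow> 'l state set \<Rightarrow> 'l state set \<Rightarrow> 'l state set" where
  "delay_until TA S1 S2 = {q \<in> ta_states TA. \<exists>d q'. ta_step TA q (Delay d) q' \<and> q' \<in> S2 \<and>
     (\<forall>d' q''. d' < d \<longrightarrow> ta_step TA q (Delay d') q'' \<longrightarrow> q'' \<in> S1 \<union> S2)}"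

definition delay_all :: "('l, 'a, 'p) ta \<Rightarrow> 'l state set \<Rightarrow> 'l state set" where
  "delay_all TA S = {q \<in> ta_states TA. \<forall>d q'. ta_step TA q (Delay d) q' \<longrightarrow> q' \<in> S}"

text \<open>The bound 1 detects any bound on the possible delays: if they are bounded, a
  sufficiently late delay successor has less than one unit left.\<close>

definition time_stop :: "('l, 'a, 'p) ta \<Rightarrow> 'l state set" where
  "time_stop TA = {q \<in> ta_states TA. \<forall>d q'. ta_step TA q (Delay d) q' \<longrightarrow> d < 1}"

definition act_some :: "('l, 'a, 'p) ta \<Rightarrow> 'l state set \<Rightarrow> 'l state set" where
  "act_some TA S = {q \<in> ta_states TA. \<exists>a q'. ta_step TA q (Act a) q' \<and> q' \<in> S}"

definition act_all :: "('l, 'a, 'p) ta \<Rightarrow> 'l state set \<Rightarrow> 'l state set" where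
  "act_all TA S = {q \<in> ta_states TA. \<forall>a q'. ta_step TA q (Act a) q' \<longrightarrow> q' \<in> S}"

lemma ta_step_delay_nonneg: "ta_step TA q (Delay d) q' \<Longrightarrow> 0 \<le> d"
  using ta_step_label_delay_nonneg by fastforce

lemma lrel_sem_LEx:
  "lrel_sem TA \<theta> (LEx \<phi>1 \<phi>2) = delay_until TA (lrel_sem TA \<theta> \<phi>1) (lrel_sem TA \<theta> \<phi>2)"
  (is "?L = ?R")
proof
  show "?L \<subseteq> ?R"
  proof
    fix q assume "q \<in> ?L"
    then obtain d q' where "q \<in> ta_states TA" "ta_step TA q (Delay d) q'" "q' \<in> lrel_sem TA \<theta> \<phi>2"
      and less: "\<And>d'. 0 \<le> d' \<Longrightarrow> d' < d \<Longrightarrow>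
        \<exists>q'. ta_step TA q (Delay d') q' \<and> q' \<in> lrel_sem TA \<theta> \<phi>1 \<union> lrel_sem TA \<theta> \<phi>2"
      by auto
    moreover have "q'' \<in> lrel_sem TA \<theta> \<phi>1 \<union> lrel_sem TA \<theta> \<phi>2"
      if "d' < d" "ta_step TA q (Delay d') q''" for d' q''
      using less[OF ta_step_delay_nonneg[OF that(2)] that(1)] ta_step_delay_unique[OF that(2)] by metis
    ultimately show "q \<in> ?R" unfolding delay_until_def by blast
  qed
  show "?R \<subseteq> ?L"
  proof
    fix q assume "q \<in> ?R"
    then obtain d q' where q: "q \<in> ta_states TA" "ta_step TA q (Delay d) q'" "q' \<in> lrel_sem TA \<theta> \<phi>2"
      and less: "\<And>d' q''. d' < d \<Longrightarrow> ta_step TA q (Delay d') q'' \<Longrightarrow>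
        q'' \<in> lrel_sem TA \<theta> \<phi>1 \<union> lrel_sem TA \<theta> \<phi>2"
      unfolding delay_until_def by blast
    have "\<exists>q'. ta_step TA q (Delay d') q' \<and> q' \<in> lrel_sem TA \<theta> \<phi>1 \<union> lrel_sem TA \<theta> \<phi>2"
      if "0 \<le> d'" "d' < d" for d'
      using less[OF that(2)] ta_step_delay_le[OF q(2) that(1)] that(2) by (meson less_imp_le)
    then show "q \<in> ?L" using q ta_step_delay_nonneg[OF q(2)] unfolding lrel_sem.simps by blast
  qed
qed

lemma lrel_sem_LAnd:
  "lrel_sem TA \<theta> (LAnd \<phi>1 \<phi>2) = ta_states TA \<inter> lrel_sem TA \<theta> \<phi>1 \<inter> lrel_sem TA \<theta> \<phi>2"
  unfolding LAnd_def lrel_sem.simps by blast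

lemma lrel_sem_LBox_UNIV:
  assumes "timed_automaton TA"
  shows "lrel_sem TA \<theta> (LBox UNIV \<phi>) = act_all TA (lrel_sem TA \<theta> \<phi>)"
  unfolding LBox_def act_all_def lrel_sem.simps using ta_step_target[OF assms] by blast

lemma lrel_sem_LDia_UNIV: "lrel_sem TA \<theta> (LDia UNIV \<phi>) = act_some TA (lrel_sem TA \<theta> \<phi>)"
  unfolding act_some_def lrel_sem.simps by blast

text \<open>Valuations of states are nonnegative, so \<open>Lff x\<close> denotes the empty set and
  the condition on earlier delays becomes trivial.\<close>

lemma lrel_sem_LAll:
  assumes "timed_automaton TA"
  shows "lrel_sem TA \<theta> (LAll x \<phi>) = delay_all TA (lrel_sem TA \<theta> \<phi>)"
proof -
  have ff: "lrel_sem TA \<theta> (Lff x) = {}"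
  proof -
    have "\<not> v x < 0" if "(l, v) \<in> ta_states TA" for l v
      using that by (simp add: ta_states_def not_less)
    then show ?thesis unfolding Lff_def lrel_sem.simps by auto
  qed
  have "lrel_sem TA \<theta> (LAll x \<phi>) =
    ta_states TA - delay_until TA (ta_states TA) (ta_states TA - lrel_sem TA \<theta> \<phi>)"
    unfolding LAll_def LAllRel_def lrel_sem.simps(3) lrel_sem_LEx ff by simp
  also have "\<dots> = delay_all TA (lrel_sem TA \<theta> \<phi>)"
    unfolding delay_until_def delay_all_def using ta_step_target[OF assms] by blast
  finally show ?thesis .
qed

lemma freeze_step_delay_iff:
  assumes "timed_automaton TA" "q \<in> ta_states TA"
  shows "(\<exists>q'. ta_step TA (freeze_state y q) (Delay d) q') \<longleftrightarrow> (\<exists>q'. ta_step TA q (Delay d) q')"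
proof -
  obtain l v where q: "q = (l, v)" by force
  then have "l \<in> ta_locs TA" using assms(2) by (simp add: ta_states_def)
  then show ?thesis
    using assms freeze_state_in_states[OF assms, of y] sat_invariant_freeze[OF assms(1)]
    by (simp add: q freeze_state_def ta_step_delay_iff)
qed

text \<open>After the freeze, clock \<open>z\<close> shows exactly the time \<open>d\<close> that
  has elapsed since, and freezing does not change which delays are possible.\<close>

lemma lrel_sem_LTS:
  assumes TA: "timed_automaton TA"
  shows "lrel_sem TA \<theta> (LTS x z) = time_stop TA"
proof -
  let ?A = "LAtom (Clk (Single (FreezeClock z) Lt 1))"
  have *: "q' \<in> lrel_sem TA \<theta> ?A \<longleftrightarrow> d < 1"
    if "ta_step TA (freeze_state z q) (Delay d) q'" for q q' d
    using ta_step_target[OF TA that] that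
    by (cases q) (auto simp: freeze_state_def ta_step_delay_iff shift_val_def reset_val_def)
  have "freeze_state z q \<in> delay_all TA (lrel_sem TA \<theta> ?A) \<longleftrightarrow> q \<in> time_stop TA"
    if q: "q \<in> ta_states TA" for q
    unfolding delay_all_def time_stop_def mem_Collect_eq
    using freeze_state_in_states[OF TA q] freeze_step_delay_iff[OF TA q] q * by metis
  then show ?thesis
    unfolding LTS_def lrel_sem.simps(7) lrel_sem_LAll[OF TA]
    by (smt (verit) Collect_cong Collect_mem_eq mem_Collect_eq time_stop_def)
qed

section \<open>The until operators as least fixpoints\<close>

lemma EU_least_fixpoint:
  assumes TA: "timed_automaton TA" and tf: "timelock_free TA"
  shows "{q \<in> ta_states TA. \<exists>\<rho>. run_from TA q \<rho> \<and> until_path \<rho> (P1 \<union> P2) P2} =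
    \<Inter> {S. S \<subseteq> ta_states TA \<and> delay_until TA P1 (P2 \<union> (P1 \<inter> act_some TA S)) \<subseteq> S}"
    (is "?EU = \<Inter> ?F")
proof
  show "?EU \<subseteq> \<Inter> ?F"
  proof (rule Inter_greatest)
    fix S assume "S \<in> ?F"
    then have S: "delay_until TA P1 (P2 \<union> (P1 \<inter> act_some TA S)) \<subseteq> S" (is "?D \<subseteq> S") by blast
    show "?EU \<subseteq> S"
    proof
      fix q assume "q \<in> ?EU"
      then obtain \<rho> where run: "run_from TA q \<rho>" and until: "until_path \<rho> (P1 \<union> P2) P2" by blast
      note len = run_from_infinite[OF run]
      obtain n e where p: "(n, e) \<in> positions \<rho>" "position_state \<rho> (n, e) \<in> P2"
        and less: "\<And>p'. p' \<in> positions \<rho> \<Longrightarrow> position_less p' (n, e) \<Longrightarrow> position_state \<rho> p' \<in> P1 \<union> P2"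
        using until by (auto simp: until_path_def simp del: position_state.simps)
      have st: "ex_state \<rho> i \<in> ta_states TA" for i using ta_step_source[OF run_from_step[OF run]] .
      have pos0: "(i, 0) \<in> positions \<rho>" "position_state \<rho> (i, 0) = ex_state \<rho> i" for i
        by (auto simp: positions_infinite[OF len] shift_val_def)
      \<comment> \<open>The downward induction carries membership in \<open>?D\<close> rather than
        in \<open>S\<close>: a delay transition must be merged with the delay witness of its target,
        which \<open>S\<close> alone does not provide.\<close>
      have "ex_state \<rho> i \<in> ?D" if "i \<le> n" for i using that
      proof (induction i rule: inc_induct)
        case base
        have "q'' \<in> P1 \<union> P2" if d: "d' < e" "ta_step TA (ex_state \<rho> n) (Delay d') q''" for d' q''
        proof -
          have "(n, d') \<in> positions \<rho>"
            using p(1) d ta_step_delay_nonneg[OF d(2)] by (auto simp: positions_infinite[OF len])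
          then have "position_state \<rho> (n, d') \<in> P1 \<union> P2" "position_state \<rho> (n, d') = q''"
            using less[of "(n, d')"] d ta_step_delay_unique[OF position_step[OF run] d(2)] by simp_all
          then show ?thesis by simp
        qed
        then show ?case using p position_step[OF run p(1)] st unfolding delay_until_def by blast
      next
        case (step i)
        have i: "ex_state \<rho> i \<in> P1 \<union> P2" using less[OF pos0(1)[of i]] step.hyps pos0(2)[of i] by simp
        show ?case
        proof (cases "ex_label \<rho> i")
          case (Act a)
          then have "ta_step TA (ex_state \<rho> i) (Act a) (ex_state \<rho> (Suc i))"
            using run_from_step[OF run, of i] by simp
          moreover have "ex_state \<rho> (Suc i) \<in> S" using step.IH S by blast
          ultimately have "ex_state \<rho> i \<in> act_some TA S" using st unfolding act_some_def by blast
          then have "ex_state \<rho> i \<in> P2 \<union> (P1 \<inter> act_some TA S)" using i by blast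
          \<comment> \<open>Before an action the witnessing delay is zero.\<close>
          moreover have "ta_step TA (ex_state \<rho> i) (Delay 0) (ex_state \<rho> i)"
            using ta_step_delay_zero st by blast
          moreover have "\<not> ta_step TA (ex_state \<rho> i) (Delay d') q''" if "d' < 0" for d' q''
            using ta_step_delay_nonneg that by fastforce
          ultimately show ?thesis using st unfolding delay_until_def by blast
        next
          case (Delay d)
          then have d: "ta_step TA (ex_state \<rho> i) (Delay d) (ex_state \<rho> (Suc i))"
            using run_from_step[OF run, of i] by simp
          obtain d1 q1 where d1: "ta_step TA (ex_state \<rho> (Suc i)) (Delay d1) q1"
            "q1 \<in> P2 \<union> (P1 \<inter> act_some TA S)"
            and less1: "\<And>d' q''. d' < d1 \<Longrightarrow> ta_step TA (ex_state \<rho> (Suc i)) (Delay d') q'' \<Longrightarrow>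
              q'' \<in> P1 \<union> (P2 \<union> (P1 \<inter> act_some TA S))"
            using step.IH unfolding delay_until_def by blast
          have "q'' \<in> P1 \<union> (P2 \<union> (P1 \<inter> act_some TA S))"
            if d': "d' < d + d1" "ta_step TA (ex_state \<rho> i) (Delay d') q''" for d' q''
          proof (cases "d' < d")
            case True
            then have "(i, d') \<in> positions \<rho>"
              using Delay ta_step_delay_nonneg[OF d'(2)] by (auto simp: positions_infinite[OF len])
            then have "position_state \<rho> (i, d') \<in> P1 \<union> P2" "position_state \<rho> (i, d') = q''"
              using less[of "(i, d')"] step.hyps ta_step_delay_unique[OF position_step[OF run] d'(2)]
              by simp_all
            then show ?thesis by blast
          next
            case False
            then have "ta_step TA (ex_state \<rho> (Suc i)) (Delay (d' - d)) q''"
              using ta_step_delay_diff[OF d d'(2) _ TA] by simp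
            then show ?thesis using less1[of "d' - d"] d'(1) by simp
          qed
          then show ?thesis
            using ta_step_delay_add[OF d d1(1)] d1(2) st unfolding delay_until_def by blast
        qed
      qed
      then show "q \<in> S" using S run_from_start[OF run] by blast
    qed
  qed
  have "delay_until TA P1 (P2 \<union> (P1 \<inter> act_some TA ?EU)) \<subseteq> ?EU"
  proof
    fix q assume "q \<in> delay_until TA P1 (P2 \<union> (P1 \<inter> act_some TA ?EU))"
    then obtain d q' where q: "q \<in> ta_states TA" "ta_step TA q (Delay d) q'"
      "q' \<in> P2 \<union> (P1 \<inter> act_some TA ?EU)"
      and less: "\<And>d' q''. d' < d \<Longrightarrow> ta_step TA q (Delay d') q'' \<Longrightarrow> q'' \<in> P1 \<union> P2"
      unfolding delay_until_def by blast
    have "\<exists>\<rho>. run_from TA q' \<rho> \<and> until_path \<rho> (P1 \<union> P2) P2"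
    proof (cases "q' \<in> P2")
      case True
      have "q' \<in> ta_states TA" using ta_step_target[OF TA q(2)] .
      \<comment> \<open>Existential until asks for a full run, so timelock-freeness has to continue
        the path beyond \<open>P2\<close>.\<close>
      then obtain \<rho> where run: "run_from TA q' \<rho>" using tf by (auto simp: timelock_free_def)
      have "until_path \<rho> (P1 \<union> P2) P2"
        unfolding until_path_def
      proof (intro bexI conjI ballI impI)
        show 0: "(0, 0) \<in> positions \<rho>" by (simp add: positions_infinite[OF run_from_infinite[OF run]])
        show "position_state \<rho> (0, 0) \<in> P2" using True run_from_start[OF run] by (simp add: shift_val_def)
        fix p' assume "p' \<in> positions \<rho>" "position_less p' (0, 0)"
        then show "position_state \<rho> p' \<in> P1 \<union> P2"
          by (cases p') (auto simp: positions_infinite[OF run_from_infinite[OF run]])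
      qed
      then show ?thesis using run by blast
    next
      case False
      then obtain a q'' \<rho> where P1: "q' \<in> P1" and a: "ta_step TA q' (Act a) q''"
        and run: "run_from TA q'' \<rho>" "until_path \<rho> (P1 \<union> P2) P2"
        using q(3) unfolding act_some_def by blast
      note len = run_from_infinite[OF run(1)]
      have "until_path (ex_cons q' (Act a) \<rho>) (P1 \<union> P2) P2"
      proof (rule until_path_cons[OF run(2) len])
        fix e assume "(0, e) \<in> positions (ex_cons q' (Act a) \<rho>)"
        then have "e = 0" using len by (simp add: positions_infinite ex_cons_def)
        then show "position_state (ex_cons q' (Act a) \<rho>) (0, e) \<in> P1 \<union> P2"
          using P1 by (simp add: ex_cons_def shift_val_def)
      qed
      then show ?thesis using run_from_cons[OF a run(1)] by blast
    qed
    then obtain \<rho> where run: "run_from TA q' \<rho>" "until_path \<rho> (P1 \<union> P2) P2" by blast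
    note len = run_from_infinite[OF run(1)]
    have "until_path (ex_cons q (Delay d) \<rho>) (P1 \<union> P2) P2"
    proof (rule until_path_cons[OF run(2) len])
      fix e assume pos: "(0, e) \<in> positions (ex_cons q (Delay d) \<rho>)"
      have "ta_step TA q (Delay e) (position_state (ex_cons q (Delay d) \<rho>) (0, e))"
        using position_step[OF run_from_cons[OF q(2) run(1)] pos] by (simp add: ex_cons_def)
      \<comment> \<open>For \<open>d = 0\<close> the initial position already shows
        \<open>q'\<close>, to which the condition on earlier delays does not apply.\<close>
      moreover have "e < d \<or> e = 0 \<and> d = 0"
        using pos len ta_step_delay_nonneg[OF q(2)] by (auto simp: positions_infinite ex_cons_def)
      ultimately show "position_state (ex_cons q (Delay d) \<rho>) (0, e) \<in> P1 \<union> P2"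
        using less q(2,3) ta_step_delay_unique by blast
    qed
    then show "q \<in> ?EU" using run_from_cons[OF q(2) run(1)] q(1) by blast
  qed
  then show "\<Inter> ?F \<subseteq> ?EU" by (intro Inter_lower) blast
qed

section \<open>The universal until\<close>

definition AU_states :: "('l, 'a, 'p) ta \<Rightarrow> 'l state set \<Rightarrow> 'l state set \<Rightarrow> 'l state set" where
  "AU_states TA P1 P2 =
     {q \<in> ta_states TA. \<forall>\<rho>. run_from TA q \<rho> \<longrightarrow> until_path \<rho> (P1 \<union> P2) P2}"

definition au_step :: "('l, 'a, 'p) ta \<Rightarrow> 'l state set \<Rightarrow> 'l state set \<Rightarrow> 'l state set \<Rightarrow> 'l state set" where
  "au_step TA P1 P2 S = delay_until TA (P1 \<inter> act_all TA S)
     (P2 \<union> (time_stop TA \<inter> delay_all TA (P1 \<inter> act_all TA S)))"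

lemma delay_all_subset: "delay_all TA S \<subseteq> S"
  unfolding delay_all_def using ta_step_delay_zero by blast

abbreviation elapsed :: "('l, 'a) execution \<Rightarrow> nat \<Rightarrow> real" where
  "elapsed \<rho> n \<equiv> (\<Sum>i<n. label_delay (ex_label \<rho> i))"

text \<open>Consecutive delays add up, so before any action has occurred each position is a single
  delay successor of the start.\<close>

lemma position_reached:
  assumes run: "run_from TA q \<rho>" and pos: "(n, e) \<in> positions \<rho>"
    and delays: "\<And>i. i < n \<Longrightarrow> \<exists>d. ex_label \<rho> i = Delay d"
  shows "ta_step TA q (Delay (elapsed \<rho> n + e)) (position_state \<rho> (n, e))"
proof -
  have "ta_step TA q (Delay (elapsed \<rho> n)) (ex_state \<rho> n)"
    using delays
  proof (induction n)
    case 0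
    have "q \<in> ta_states TA" using run by (simp add: run_from_def execution_from_def)
    then show ?case using ta_step_delay_zero[of q TA] run_from_start[OF run] by simp
  next
    case (Suc n)
    obtain d where d: "ex_label \<rho> n = Delay d" using Suc.prems by blast
    have "ta_step TA q (Delay (elapsed \<rho> n)) (ex_state \<rho> n)" using Suc by simp
    moreover have "ta_step TA (ex_state \<rho> n) (Delay d) (ex_state \<rho> (Suc n))"
      using run_from_step[OF run, of n] d by simp
    ultimately show ?case using ta_step_delay_add d by fastforce
  qed
  then show ?thesis using ta_step_delay_add position_step[OF run pos] by blast
qed

text \<open>Only weak monotonicity is available, as actions and zero delays take no time.\<close>

lemma position_elapsed_mono:
  assumes run: "run_from TA q \<rho>"
    and pos: "(i, e) \<in> positions \<rho>" "(j, e') \<in> positions \<rho>" "position_less (i, e) (j, e')"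
  shows "elapsed \<rho> i + e \<le> elapsed \<rho> j + e'"
proof (cases "i < j")
  case True
  note len = run_from_infinite[OF run]
  have nn: "0 \<le> label_delay (ex_label \<rho> k)" for k
    using run_from_step[OF run] by (rule ta_step_label_delay_nonneg)
  have "e \<le> label_delay (ex_label \<rho> i)" "0 \<le> e'"
    using pos nn[of i] by (auto simp: positions_infinite[OF len])
  then have "elapsed \<rho> i + e \<le> elapsed \<rho> (Suc i) + e'" by simp
  also have "elapsed \<rho> (Suc i) \<le> elapsed \<rho> j"
    by (rule sum_mono2) (use True nn in auto)
  finally show ?thesis by simp
qed (use pos(3) in simp)

lemma until_path_first_position:
  assumes "run_from TA q \<rho>" "until_path \<rho> Q1 Q2"
  shows "q \<in> Q1 \<union> Q2"
proof -
  have q: "position_state \<rho> (0, 0) = q" using run_from_start[OF assms(1)] by (simp add: shift_val_def)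
  have 0: "(0, 0) \<in> positions \<rho>" by (simp add: positions_infinite[OF run_from_infinite[OF assms(1)]])
  obtain i e where p: "(i, e) \<in> positions \<rho>" "position_state \<rho> (i, e) \<in> Q2"
    and less: "\<And>p'. p' \<in> positions \<rho> \<Longrightarrow> position_less p' (i, e) \<Longrightarrow> position_state \<rho> p' \<in> Q1"
    using assms(2) by (auto simp: until_path_def simp del: position_state.simps)
  have "(i, e) = (0, 0) \<or> position_less (0, 0) (i, e)"
    using p(1) by (auto simp: positions_infinite[OF run_from_infinite[OF assms(1)]])
  then show ?thesis
  proof
    assume "(i, e) = (0, 0)"
    then show ?thesis using p(2) q by (metis UnCI)
  qed (use less[OF 0] q in simp)
qed

text \<open>Either \<open>q'\<close> is in \<open>P2\<close> and the run delays up to time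
  \<open>d\<close>, which yields the until position, or the run performs an action. In the latter
  case everything up to the first action lies in \<open>\<Gamma> \<union> P2\<close>, so either
  \<open>P2\<close> holds just before it or the target satisfies the until.\<close>

lemma au_step_AU_states:
  assumes TA: "timed_automaton TA"
  shows "au_step TA P1 P2 (AU_states TA P1 P2) \<subseteq> AU_states TA P1 P2"
proof
  let ?AU = "AU_states TA P1 P2"
  define \<Gamma> where "\<Gamma> = P1 \<inter> act_all TA ?AU"
  fix q assume "q \<in> au_step TA P1 P2 ?AU"
  then obtain d q' where q: "q \<in> ta_states TA" "ta_step TA q (Delay d) q'"
    "q' \<in> P2 \<union> (time_stop TA \<inter> delay_all TA \<Gamma>)"
    and less': "\<And>d' q''. d' < d \<Longrightarrow> ta_step TA q (Delay d') q'' \<Longrightarrow>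
      q'' \<in> \<Gamma> \<union> (P2 \<union> (time_stop TA \<inter> delay_all TA \<Gamma>))"
    unfolding au_step_def delay_until_def \<Gamma>_def by blast
  have less: "q'' \<in> \<Gamma> \<union> P2" if "d' < d" "ta_step TA q (Delay d') q''" for d' q''
    using less'[OF that] delay_all_subset[of TA \<Gamma>] by blast
  have "until_path \<rho> (P1 \<union> P2) P2" if run: "run_from TA q \<rho>" for \<rho>
  proof -
    note len = run_from_infinite[OF run]
    note pos_iff = positions_infinite[OF len]
    show ?thesis
    proof (cases "q' \<in> P2 \<and> (\<exists>k. d \<le> elapsed \<rho> k \<and> (\<forall>i<k. \<exists>d. ex_label \<rho> i = Delay d))")
      case True
      \<comment> \<open>Taking the least such index ensures that time \<open>d\<close> is either the
        target of the last of these delays or strictly inside it.\<close>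
      define k where "k = (LEAST k. d \<le> elapsed \<rho> k \<and> (\<forall>i<k. \<exists>d. ex_label \<rho> i = Delay d))"
      have k: "d \<le> elapsed \<rho> k" "\<forall>i<k. \<exists>d. ex_label \<rho> i = Delay d"
        unfolding k_def using LeastI_ex[OF conjunct2[OF True]] by blast+
      have "\<exists>n e. (n, e) \<in> positions \<rho> \<and> n \<le> k \<and> elapsed \<rho> n + e = d"
      proof (cases "elapsed \<rho> k = d")
        case True
        then show ?thesis by (intro exI[of _ k] exI[of _ 0]) (simp add: pos_iff)
      next
        case False
        then have "d < elapsed \<rho> k" using k by simp
        then obtain m where m: "k = Suc m" using ta_step_delay_nonneg[OF q(2)] by (cases k) auto
        then have "\<not> d \<le> elapsed \<rho> m"
          using not_less_Least[of m "\<lambda>k. d \<le> elapsed \<rho> k \<and> (\<forall>i<k. \<exists>d. ex_label \<rho> i = Delay d)"] k(2)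
          unfolding k_def[symmetric] by (simp del: sum.lessThan_Suc)
        moreover obtain d1 where "ex_label \<rho> m = Delay d1" using k m by blast
        ultimately have "(m, d - elapsed \<rho> m) \<in> positions \<rho>"
          using \<open>d < elapsed \<rho> k\<close> m by (simp add: pos_iff)
        then show ?thesis using m by (intro exI[of _ m] exI[of _ "d - elapsed \<rho> m"]) simp
      qed
      then obtain n e where p: "(n, e) \<in> positions \<rho>" "n \<le> k" "elapsed \<rho> n + e = d" by blast
      have reach: "ta_step TA q (Delay (elapsed \<rho> i + e')) (position_state \<rho> (i, e'))"
        if "(i, e') \<in> positions \<rho>" "i \<le> n" for i e'
        by (rule position_reached[OF run that(1)]) (use that p k in auto)
      have "position_state \<rho> (n, e) = q'"
        using ta_step_delay_unique[OF reach[OF p(1)]] q(2) p(3) by simp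
      moreover have "position_state \<rho> p' \<in> P1 \<union> P2"
        if p': "p' \<in> positions \<rho>" "position_less p' (n, e)" for p'
      proof -
        obtain i e' where [simp]: "p' = (i, e')" by force
        have "i \<le> n" using p' by auto
        then have r: "ta_step TA q (Delay (elapsed \<rho> i + e')) (position_state \<rho> p')"
          using reach p' by simp
        have "elapsed \<rho> i + e' \<le> d"
          using position_elapsed_mono[OF run _ p(1), of i e'] p' p(3) by simp
        then show ?thesis
        proof (cases "elapsed \<rho> i + e' = d")
          case True
          \<comment> \<open>Because of zero delays an earlier position may also have time
            \<open>d\<close>; it shows the same state, which lies in \<open>P2\<close>.\<close>
          then have "position_state \<rho> p' = q'" using r q(2) ta_step_delay_unique by metis
          then show ?thesis using \<open>q' \<in> P2 \<and> _\<close> by simp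
        next
          case False
          then show ?thesis using less[OF _ r] \<open>elapsed \<rho> i + e' \<le> d\<close> unfolding \<Gamma>_def by auto
        qed
      qed
      ultimately show ?thesis using p(1) True unfolding until_path_def by metis
    next
      case False
      \<comment> \<open>A run of delays alone would pass time \<open>d\<close>, so by the case
        assumption \<open>q'\<close> is a time stop, against divergence.\<close>
      have "\<exists>n a. ex_label \<rho> n = Act a"
      proof (rule ccontr)
        assume "\<not> ?thesis"
        then have delays: "\<exists>d. ex_label \<rho> i = Delay d" for i by (metis label.exhaust)
        obtain k where k: "d + 1 \<le> elapsed \<rho> k" using run_from_unbounded[OF run] .
        then have "d \<le> elapsed \<rho> k" by simp
        then have "q' \<in> time_stop TA" using q(3) False delays by blast
        moreover have "ta_step TA q (Delay (elapsed \<rho> k + 0)) (position_state \<rho> (k, 0))"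
          by (rule position_reached[OF run]) (use delays in \<open>auto simp: pos_iff\<close>)
        then have "ta_step TA q' (Delay (elapsed \<rho> k + 0 - d)) (position_state \<rho> (k, 0))"
          by (rule ta_step_delay_diff[OF q(2) _ _ TA]) (use k in simp)
        ultimately have "elapsed \<rho> k + 0 - d < 1" unfolding time_stop_def by blast
        then show False using k by simp
      qed
      then obtain n where n: "\<exists>a. ex_label \<rho> n = Act a" "\<And>i. i < n \<Longrightarrow> \<not> (\<exists>a. ex_label \<rho> i = Act a)"
        using exists_least_iff[of "\<lambda>n. \<exists>a. ex_label \<rho> n = Act a"] by blast
      then have delays: "\<exists>d. ex_label \<rho> i = Delay d" if "i < n" for i using that by (metis label.exhaust)
      have upto: "s \<in> \<Gamma> \<union> P2" if s: "t \<le> elapsed \<rho> n" "ta_step TA q (Delay t) s" for t s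
      proof (cases "t < d")
        case True
        then show ?thesis using less s by blast
      next
        case False
        \<comment> \<open>Otherwise \<open>n\<close> would be an index \<open>k\<close> of the kind
          excluded by the case assumption.\<close>
        then have "q' \<notin> P2" using \<open>\<not> (q' \<in> P2 \<and> _)\<close> delays s(1) by (meson not_less order_trans)
        then have "q' \<in> delay_all TA \<Gamma>" using q(3) by blast
        moreover have "ta_step TA q' (Delay (t - d)) s"
          using ta_step_delay_diff[OF q(2) s(2) _ TA] False by simp
        ultimately show ?thesis unfolding delay_all_def by blast
      qed
      have pos0: "(n, 0) \<in> positions \<rho>" "position_state \<rho> (n, 0) = ex_state \<rho> n"
        by (simp_all add: pos_iff shift_val_def)
      have before: "position_state \<rho> (i, e) \<in> \<Gamma> \<union> P2"
        if i: "(i, e) \<in> positions \<rho>" "i \<le> n" for i e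
      proof -
        have r: "ta_step TA q (Delay (elapsed \<rho> i + e)) (position_state \<rho> (i, e))"
          by (rule position_reached[OF run i(1)]) (use i delays in auto)
        \<comment> \<open>Transition \<open>n\<close> is an action, so it contributes no interior
          positions.\<close>
        have "i = n \<and> e = 0 \<or> position_less (i, e) (n, 0)"
          using i n(1) by (auto simp: pos_iff)
        then have "elapsed \<rho> i + e \<le> elapsed \<rho> n"
          using position_elapsed_mono[OF run i(1) pos0(1)] by auto
        then show ?thesis using upto r by blast
      qed
      show ?thesis
      proof (cases "ex_state \<rho> n \<in> P2")
        case True
        have "position_state \<rho> p' \<in> P1 \<union> P2"
          if "p' \<in> positions \<rho>" "position_less p' (n, 0)" for p'
          using before[of "fst p'" "snd p'"] that unfolding \<Gamma>_def by (cases p') auto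
        then show ?thesis using True pos0 unfolding until_path_def by metis
      next
        case False
        then have "ex_state \<rho> n \<in> \<Gamma>" using before[OF pos0(1)] pos0(2) by auto
        then have "ex_state \<rho> (Suc n) \<in> ?AU"
          using n(1) run_from_step[OF run, of n] unfolding \<Gamma>_def act_all_def by fastforce
        then have "until_path (ex_drop (Suc n) \<rho>) (P1 \<union> P2) P2"
          using run_from_drop[OF TA run, of "Suc n"] unfolding AU_states_def by blast
        then show ?thesis
        proof (rule until_path_drop[OF _ len])
          fix i e assume "i < Suc n" "(i, e) \<in> positions \<rho>"
          then show "position_state \<rho> (i, e) \<in> P1 \<union> P2"
            using before[of i e] unfolding \<Gamma>_def by auto
        qed
      qed
    qed
  qed
  then show "q \<in> ?AU" using q(1) unfolding AU_states_def by blast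
qed

lemma run_from_unit_delays:
  assumes "q \<in> ta_states TA" "\<And>n. \<exists>q'. ta_step TA q (Delay (real n)) q'" "timed_automaton TA"
  shows "run_from TA q \<lparr>ex_len = \<infinity>, ex_state = \<lambda>n. (fst q, shift_val (snd q) (real n)),
    ex_label = \<lambda>_. Delay 1\<rparr>"
proof -
  have reach: "ta_step TA q (Delay (real n)) (fst q, shift_val (snd q) (real n))" for n
    using assms(2)[of n] ta_step_delay_le[of TA q "real n" _ "real n"] by fastforce
  have "ta_step TA (fst q, shift_val (snd q) (real n)) (Delay 1)
      (fst q, shift_val (snd q) (real (Suc n)))" for n
    using ta_step_delay_diff[OF reach[of n] reach[of "Suc n"] _ assms(3)] by simp
  moreover have "(\<Sum>i::nat. 1 :: ennreal) = \<infinity>"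
  proof (rule ccontr)
    assume "(\<Sum>i::nat. 1 :: ennreal) \<noteq> \<infinity>"
    then obtain n where n: "(\<Sum>i::nat. 1 :: ennreal) < of_nat n"
      using ennreal_Ex_less_of_nat by (auto simp: less_top)
    have "of_nat n = (\<Sum>i<n. 1 :: ennreal)" by simp
    also have "\<dots> \<le> (\<Sum>i::nat. 1)" by (rule sum_le_suminf) simp_all
    also note n
    finally show False by simp
  qed
  ultimately show ?thesis
    using assms(1) by (simp add: run_from_def execution_from_def duration_def shift_val_def)
qed

lemma AU_states_step:
  fixes TA :: "('l, 'a, 'p) ta"
  assumes TA: "timed_automaton TA" and tf: "timelock_free TA" and rc: "right_constant TA P2"
    and S: "au_step TA P1 P2 S \<subseteq> S" and q: "q \<in> AU_states TA P1 P2" "q \<notin> S"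
  shows "\<exists>b a q1 q2. ta_step TA q (Delay b) q1 \<and> ta_step TA q1 (Act a) q2 \<and>
    (\<forall>d q'. d \<le> b \<longrightarrow> ta_step TA q (Delay d) q' \<longrightarrow> q' \<notin> P2) \<and> q2 \<in> AU_states TA P1 P2 - S"
proof (rule ccontr)
  assume contr: "\<not> ?thesis"
  define \<Gamma> where "\<Gamma> = P1 \<inter> act_all TA S"
  have qs: "q \<in> ta_states TA" using q(1) by (simp add: AU_states_def)
  have until: "until_path \<rho> (P1 \<union> P2) P2" if "run_from TA q \<rho>" for \<rho>
    using q(1) that by (simp add: AU_states_def)
  \<comment> \<open>As long as \<open>P2\<close> has not been met, the until condition passes to
    delay successors and on through actions. The negated claim then leaves no action successor
    outside \<open>S\<close>.\<close>
  have no_P2: "q1 \<in> \<Gamma>" if b: "ta_step TA q (Delay b) q1"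
    and avoid: "\<And>d q'. d \<le> b \<Longrightarrow> ta_step TA q (Delay d) q' \<Longrightarrow> q' \<notin> P2" for b q1
  proof -
    have tail: "until_path \<rho> (P1 \<union> P2) P2" if run: "run_from TA q1 \<rho>" for \<rho>
    proof (rule until_path_cons_dest)
      have run': "run_from TA q (ex_cons q (Delay b) \<rho>)" by (rule run_from_cons[OF b run])
      then show "until_path (ex_cons q (Delay b) \<rho>) (P1 \<union> P2) P2" by (rule until)
      show "ex_len \<rho> = \<infinity>" by (rule run_from_infinite[OF run])
      fix e assume pos: "(0, e) \<in> positions (ex_cons q (Delay b) \<rho>)"
      then have "e \<le> b" using ta_step_delay_nonneg[OF b]
        by (auto simp: positions_infinite[OF run_from_infinite[OF run']]) (auto simp: ex_cons_def)
      moreover have "ta_step TA q (Delay e) (position_state (ex_cons q (Delay b) \<rho>) (0, e))"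
        using position_step[OF run' pos] by (simp add: ex_cons_def)
      ultimately show "position_state (ex_cons q (Delay b) \<rho>) (0, e) \<notin> P2" using avoid by blast
    qed
    have q1: "q1 \<in> ta_states TA" "q1 \<notin> P2" using ta_step_target[OF TA b] avoid[OF _ b] by simp_all
    \<comment> \<open>Some run is needed here: with no run from \<open>q1\<close>, the until
      condition would hold vacuously and say nothing about \<open>P1\<close>.\<close>
    then obtain \<rho> where "run_from TA q1 \<rho>" using tf by (auto simp: timelock_free_def)
    then have "q1 \<in> P1" using until_path_first_position tail q1(2) by blast
    moreover have "q2 \<in> S" if a: "ta_step TA q1 (Act a) q2" for a q2
    proof (rule ccontr)
      assume "q2 \<notin> S"
      have "until_path \<rho> (P1 \<union> P2) P2" if run: "run_from TA q2 \<rho>" for \<rho>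
      proof (rule until_path_cons_dest)
        have run': "run_from TA q1 (ex_cons q1 (Act a) \<rho>)" by (rule run_from_cons[OF a run])
        then show "until_path (ex_cons q1 (Act a) \<rho>) (P1 \<union> P2) P2" by (rule tail)
        show "ex_len \<rho> = \<infinity>" by (rule run_from_infinite[OF run])
        fix e assume "(0, e) \<in> positions (ex_cons q1 (Act a) \<rho>)"
        then have "e = 0"
          by (auto simp: positions_infinite[OF run_from_infinite[OF run']]) (auto simp: ex_cons_def)
        then show "position_state (ex_cons q1 (Act a) \<rho>) (0, e) \<notin> P2"
          using q1(2) by (simp add: ex_cons_def shift_val_def)
      qed
      then have "q2 \<in> AU_states TA P1 P2"
        using ta_step_target[OF TA a] unfolding AU_states_def by blast
      then show False using contr b a avoid \<open>q2 \<notin> S\<close> by blast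
    qed
    ultimately show ?thesis using q1(1) unfolding \<Gamma>_def act_all_def by blast
  qed
  \<comment> \<open>Such a delay would put \<open>q\<close> into the prefixpoint
    \<open>S\<close>.\<close>
  have not_step: False if "ta_step TA q (Delay d) q'" "q' \<in> P2 \<union> (time_stop TA \<inter> delay_all TA \<Gamma>)"
    "\<And>d' q''. d' < d \<Longrightarrow> ta_step TA q (Delay d') q'' \<Longrightarrow> q'' \<in> \<Gamma> \<union> P2" for d q'
  proof -
    have "q \<in> au_step TA P1 P2 S"
      using that qs unfolding au_step_def delay_until_def \<Gamma>_def by blast
    then show False using S q(2) by blast
  qed
  define G where "G = {d. \<exists>q'. ta_step TA q (Delay d) q' \<and> q' \<in> P2}"
  show False
  proof (cases "G = {}")
    \<comment> \<open>If no delay leads to \<open>P2\<close>, all delay successors lie in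
      \<open>\<Gamma>\<close>, so none of them may be a time stop. Time then passes without bound,
      and the run of unit delays violates the until.\<close>
    case True
    then have no: "q' \<notin> P2" if "ta_step TA q (Delay d) q'" for d q'
      using that unfolding G_def by blast
    have all: "q' \<in> \<Gamma>" if "ta_step TA q (Delay d) q'" for d q'
      using no_P2[OF that] no by blast
    have "q' \<notin> time_stop TA" if "ta_step TA q (Delay d) q'" for d q'
    proof
      assume "q' \<in> time_stop TA"
      moreover have "q' \<in> delay_all TA \<Gamma>"
        unfolding delay_all_def using all ta_step_delay_add[OF that] ta_step_target[OF TA that] by blast
      ultimately show False using not_step[OF that] all by blast
    qed
    note no_stop = this
    have far: "\<exists>q''. ta_step TA q (Delay (d + 1)) q''" if d: "ta_step TA q (Delay d) q'" for d q'
    proof -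
      obtain e q'' where "ta_step TA q' (Delay e) q''" "1 \<le> e"
        using no_stop[OF d] ta_step_target[OF TA d] unfolding time_stop_def
        by (auto simp: not_less)
      then have "ta_step TA q' (Delay 1) (fst q', shift_val (snd q') 1)"
        using ta_step_delay_le[of TA q' e q'' 1] by simp
      then show ?thesis using ta_step_delay_add[OF d] by blast
    qed
    have reach: "\<exists>q'. ta_step TA q (Delay (real n)) q'" for n
    proof (induction n)
      case 0
      then show ?case using ta_step_delay_zero[OF qs] by auto
    next
      case (Suc n)
      then show ?case using far by (metis of_nat_Suc add.commute)
    qed
    define \<rho> :: "('l, 'a) execution" where "\<rho> = \<lparr>ex_len = \<infinity>,
      ex_state = \<lambda>n. (fst q, shift_val (snd q) (real n)), ex_label = \<lambda>_. Delay 1\<rparr>"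
    have run: "run_from TA q \<rho>" unfolding \<rho>_def by (rule run_from_unit_delays[OF qs reach TA])
    then obtain n e where p: "(n, e) \<in> positions \<rho>" "position_state \<rho> (n, e) \<in> P2"
      using until[OF run] unfolding until_path_def by (metis surj_pair)
    have "ta_step TA q (Delay (elapsed \<rho> n + e)) (position_state \<rho> (n, e))"
      by (rule position_reached[OF run p(1)]) (simp add: \<rho>_def)
    then show False using no p(2) by blast
  next
    case False
    define g where "g = Inf G"
    have bdd: "bdd_below G"
      unfolding G_def using ta_step_delay_nonneg by (intro bdd_belowI[of _ 0]) blast
    have lower: "q' \<notin> P2" if "ta_step TA q (Delay d) q'" "d < g" for d q'
    proof
      assume "q' \<in> P2"
      then have "d \<in> G" using that unfolding G_def by blast
      then show False using cInf_lower[OF _ bdd, of d] that(2) by (simp add: g_def)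
    qed
    have below: "q' \<in> \<Gamma>" if "ta_step TA q (Delay d) q'" "d < g" for d q'
      using no_P2[OF that(1)] lower that(2) by (meson le_less_trans)
    show False
    proof (cases "g \<in> G")
      case True
      \<comment> \<open>An attained infimum serves as the witnessing delay itself.\<close>
      then show False using not_step[of g] below unfolding G_def by blast
    next
      \<comment> \<open>Here \<open>P2\<close> is avoided up to and including \<open>g\<close>,
        which gives \<open>\<Gamma>\<close> there. Some delay \<open>d\<close> shortly after
        \<open>g\<close> leads to \<open>P2\<close>, and right constancy spreads \<open>P2\<close>
        over all delays between \<open>g\<close> and \<open>d\<close>.\<close>
      case gG: False
      obtain \<epsilon> where \<epsilon>: "0 < \<epsilon>" and right: "\<And>d1 d2 q1 q2. g < d1 \<Longrightarrow> d1 < g + \<epsilon> \<Longrightarrow> g < d2 \<Longrightarrow>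
        d2 < g + \<epsilon> \<Longrightarrow> ta_step TA q (Delay d1) q1 \<Longrightarrow> ta_step TA q (Delay d2) q2 \<Longrightarrow> q1 \<in> P2 \<Longrightarrow> q2 \<in> P2"
        using rc unfolding right_constant_def by meson
      obtain d where d: "d \<in> G" "d < g + \<epsilon>"
        using cInf_lessD[OF False, of "g + \<epsilon>"] \<epsilon> unfolding g_def by auto
      have "g \<le> d" using cInf_lower[OF d(1) bdd] by (simp add: g_def)
      then have "g < d" using d(1) gG by (metis order_le_less)
      obtain q' where q': "ta_step TA q (Delay d) q'" "q' \<in> P2" using d(1) unfolding G_def by blast
      have "q'' \<in> \<Gamma> \<union> P2" if d': "d' < d" "ta_step TA q (Delay d') q''" for d' q''
      proof (cases "d' \<le> g")
        case True
        have "s \<notin> P2" if "t \<le> d'" "ta_step TA q (Delay t) s" for t s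
        proof (cases "t < g")
          case True
          then show ?thesis using lower that(2) by blast
        next
          case False
          then have "t = g" using that(1) \<open>d' \<le> g\<close> by simp
          then show ?thesis using that(2) gG unfolding G_def by blast
        qed
        then show ?thesis using no_P2[OF d'(2)] by blast
      next
        case False
        then show ?thesis using right[of d d' q' q''] q' d' d \<open>g < d\<close> by simp
      qed
      then show False using not_step[OF q'(1)] q'(2) by blast
    qed
  qed
qed

lemma AU_states_subset:
  assumes TA: "timed_automaton TA" and tf: "timelock_free TA" and nz: "non_zeno TA"
    and rc: "right_constant TA P2" and S: "au_step TA P1 P2 S \<subseteq> S"
  shows "AU_states TA P1 P2 \<subseteq> S"
proof (rule ccontr)
  assume "\<not> ?thesis"
  then obtain q where q: "q \<in> AU_states TA P1 P2 - S" by blast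
  let ?W = "AU_states TA P1 P2 - S"
  define R where "R q b a q1 q2 \<longleftrightarrow> ta_step TA q (Delay b) q1 \<and> ta_step TA q1 (Act a) q2 \<and>
    (\<forall>d q'. d \<le> b \<longrightarrow> ta_step TA q (Delay d) q' \<longrightarrow> q' \<notin> P2)" for q b a q1 q2
  have step: "\<exists>q2. q2 \<in> ?W \<and> (\<exists>b a q1. R q b a q1 q2)" if "q \<in> ?W" for q
    using AU_states_step[OF TA tf rc S, of q] that unfolding R_def by blast
  have "\<exists>f. \<forall>n. (f n \<in> ?W \<and> (n = 0 \<longrightarrow> f n = q)) \<and> (\<exists>b a q1. R (f n) b a q1 (f (Suc n)))"
    by (rule dependent_nat_choice) (use q step in blast)+
  then obtain f where f: "\<And>n. f n \<in> ?W" "f 0 = q" "\<And>n. \<exists>b a q1. R (f n) b a q1 (f (Suc n))" by blast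
  then obtain b a m where R: "\<And>n. R (f n) (b n) (a n) (m n) (f (Suc n))" by metis
  \<comment> \<open>The steps are interleaved: even transitions are the delays from
    \<open>f n\<close> to \<open>m n\<close>, odd ones the actions from \<open>m n\<close> to
    \<open>f (Suc n)\<close>.\<close>
  define \<rho> where "\<rho> = \<lparr>ex_len = \<infinity>, ex_state = \<lambda>i. if even i then f (i div 2) else m (i div 2),
    ex_label = \<lambda>i. if even i then Delay (b (i div 2)) else Act (a (i div 2))\<rparr>"
  have qs: "q \<in> ta_states TA" using q by (simp add: AU_states_def)
  have "ta_step TA (ex_state \<rho> i) (ex_label \<rho> i) (ex_state \<rho> (Suc i))" for i
    using R[of "i div 2"] unfolding R_def by (auto simp: \<rho>_def elim!: evenE oddE)
  then have exec: "execution_from TA q \<rho>"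
    using qs f(2) by (simp add: execution_from_def) (simp add: \<rho>_def)
  have "infinite {i. enat i < ex_len \<rho> \<and> (\<exists>a. ex_label \<rho> i = Act a)}"
  proof -
    have "range (\<lambda>n. 2 * n + 1) \<subseteq> {i. enat i < ex_len \<rho> \<and> (\<exists>a. ex_label \<rho> i = Act a)}"
      by (auto simp: \<rho>_def)
    moreover have "infinite (range (\<lambda>n :: nat. 2 * n + 1))"
      by (rule range_inj_infinite) (simp add: inj_def)
    ultimately show ?thesis using infinite_super by blast
  qed
  then have "\<not> duration \<rho> < \<infinity>" using nz exec qs unfolding non_zeno_def by blast
  then have "duration \<rho> = \<infinity>" by (metis infinity_ennreal_def less_top)
  then have run: "run_from TA q \<rho>" using exec by (simp add: run_from_def)
  then have "until_path \<rho> (P1 \<union> P2) P2" using q unfolding AU_states_def by blast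
  then obtain i e where p: "(i, e) \<in> positions \<rho>" "position_state \<rho> (i, e) \<in> P2"
    unfolding until_path_def by (metis surj_pair)
  note pstep = position_step[OF run p(1)]
  note pos_iff = positions_infinite[OF run_from_infinite[OF run]]
  show False
  \<comment> \<open>Positions at even \<open>i\<close> are delays of at most
    \<open>b (i div 2)\<close>; at odd \<open>i\<close> only the source \<open>m (i div 2)\<close>
    of the action is a position. Both avoid \<open>P2\<close>.\<close>
  proof (cases "even i")
    case True
    then have "ex_state \<rho> i = f (i div 2)" "ex_label \<rho> i = Delay (b (i div 2))" by (simp_all add: \<rho>_def)
    moreover have "0 \<le> b (i div 2)" using R[of "i div 2"] ta_step_delay_nonneg unfolding R_def by blast
    ultimately have "e \<le> b (i div 2)" using p(1) by (auto simp: pos_iff)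
    then show False
      using R[of "i div 2"] pstep p(2) \<open>ex_state \<rho> i = _\<close> unfolding R_def by metis
  next
    case False
    then have "e = 0" "ex_state \<rho> i = m (i div 2)" using p(1)[unfolded pos_iff] by (auto simp: \<rho>_def)
    then have "m (i div 2) \<in> P2" using p(2) by (simp add: shift_val_def)
    then show False using R[of "i div 2"] unfolding R_def by blast
  qed
qed

lemma AU_least_fixpoint:
  assumes TA: "timed_automaton TA" and tf: "timelock_free TA" and nz: "non_zeno TA"
    and rc: "right_constant TA P2"
  shows "AU_states TA P1 P2 = \<Inter> {S. S \<subseteq> ta_states TA \<and> au_step TA P1 P2 S \<subseteq> S}"
proof
  show "AU_states TA P1 P2 \<subseteq> \<Inter> {S. S \<subseteq> ta_states TA \<and> au_step TA P1 P2 S \<subseteq> S}"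
    using AU_states_subset[OF assms] by blast
  show "\<Inter> {S. S \<subseteq> ta_states TA \<and> au_step TA P1 P2 S \<subseteq> S} \<subseteq> AU_states TA P1 P2"
    by (rule Inter_lower) (use au_step_AU_states[OF TA] in \<open>auto simp: AU_states_def\<close>)
qed

section \<open>Correctness of the translation by induction on the formula\<close>

lemma tctl_sem_subset_states: "tctl_sem TA \<phi> \<subseteq> ta_states TA"
  by (induction \<phi>) auto

theorem theorem1:
  fixes TA :: "('l, 'a, 'p) ta" and \<phi> :: "'p tctl"
    and x :: clock and z X :: nat and \<theta> :: "nat \<Rightarrow> 'l state set"
  assumes "timed_automaton TA"
    and "timelock_free TA"
    and "non_zeno TA"
    and "\<forall>Y. \<theta> Y \<subseteq> ta_states TA"
  shows "tctl_sem TA \<phi> = lrel_sem TA \<theta> (emb_tn x z X \<phi>)"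
proof -
  note TA = assms(1)
  \<comment> \<open>The environment is generalised because the until cases evaluate the subformulas
    under \<open>\<theta>'(X := S)\<close>.\<close>
  have "tctl_sem TA \<phi> = lrel_sem TA \<theta>' (emb_tn x z X \<phi>)" for \<theta>' :: "nat \<Rightarrow> 'l state set"
  proof (induction \<phi> arbitrary: \<theta>')
    case (TAU \<phi>1 \<phi>2)
    let ?P1 = "tctl_sem TA \<phi>1" and ?P2 = "tctl_sem TA \<phi>2"
    \<comment> \<open>Right constancy was shown for translated formulas; the induction hypothesis
      transfers it to the TCTL semantics of \<open>\<phi>2\<close>.\<close>
    have "right_constant TA ?P2" unfolding TAU.IH(2)[of \<theta>'] by (rule right_constant_emb_tn[OF TA])
    from AU_least_fixpoint[OF assms(1-3) this, of ?P1]
    have "tctl_sem TA (TAU \<phi>1 \<phi>2) = \<Inter> {S. S \<subseteq> ta_states TA \<and> au_step TA ?P1 ?P2 S \<subseteq> S}"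
      by (simp add: AU_states_def)
    moreover have "lrel_sem TA (\<theta>'(X := S)) (Lau x z (LAnd (emb_tn x z X \<phi>1) (LBox UNIV (LVar X)))
        (emb_tn x z X \<phi>2)) = au_step TA ?P1 ?P2 S" for S
    proof -
      \<comment> \<open>These absorb the intersections with the state space that \<open>LAnd\<close>
        introduces.\<close>
      have "ta_states TA \<inter> ?P1 = ?P1" "ta_states TA \<inter> time_stop TA = time_stop TA"
        using tctl_sem_subset_states[of TA \<phi>1] by (auto simp: time_stop_def)
      then show ?thesis
        unfolding Lau_def lrel_sem_LEx lrel_sem_LAnd lrel_sem_LTS[OF TA] lrel_sem_LAll[OF TA]
          lrel_sem_LBox_UNIV[OF TA] lrel_sem.simps(2,4) TAU.IH[symmetric] au_step_def
        by simp
    qed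
    ultimately show ?case by simp
  next
    case (TEU \<phi>1 \<phi>2)
    let ?P1 = "tctl_sem TA \<phi>1" and ?P2 = "tctl_sem TA \<phi>2"
    have "ta_states TA \<inter> ?P1 = ?P1" using tctl_sem_subset_states[of TA \<phi>1] by blast
    then have "lrel_sem TA (\<theta>'(X := S)) (LEx (emb_tn x z X \<phi>1) (LOr (emb_tn x z X \<phi>2)
        (LAnd (emb_tn x z X \<phi>1) (LDia UNIV (LVar X))))) =
      delay_until TA ?P1 (?P2 \<union> (?P1 \<inter> act_some TA S))" for S
      unfolding lrel_sem_LEx lrel_sem_LAnd lrel_sem_LDia_UNIV lrel_sem.simps(2,4) TEU.IH[symmetric]
      by simp
    then show ?case using EU_least_fixpoint[OF assms(1,2), of ?P1 ?P2] by simp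
  qed simp_all
  then show ?thesis .
qed

end
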